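(* Let $P:\mathbb{C}\to\mathbb{R}$ be smooth, subharmonic and non-harmonic, and let $\Omega=\{(z_1,z_2)\in\mathbb{C}^2:\Im(z_2)>P(z_1)\}$. If ${\rm b}\Omega$ has a uniform global structure $(f(\delta),\delta_0)$, then $\delta\lesssim f(\delta)\lesssim\delta^2$; that is, there are constants $c,C>0$ such that $c\,\delta\le f(\delta)\le C\,\delta^2$ for all $\delta\ge\delta_0$.
   Context: ${\rm b}\Omega$ is identified with $\mathbb{C}\times\mathbb{R}$ via $(z,t+iP(z))\sim(z,t)\sim(x,y,t)$, $z=x+iy$. $FPWS[0,1]$: real functions $f$ on $[0,1]$ for which there are finitely many points $0=a_0<a_1<\dots<a_{N+1}=1$ such that, for each $i$, $f$ is smooth on $(a_i,a_{i+1})$ and $f|_{(a_i,a_{i+1})}$ extends continuously to $[a_i,a_{i+1}]$. $\mathscr{X}^\ast$ is the set of pairs $(\alpha,\beta)$ with $\alpha,\beta\in FPWS[0,1]$, $|\alpha(s)|^2+|\beta(s)|^2<1$, $\int_0^1\alpha=\int_0^1\beta=0$. For $z_0=x_0+iy_0$, $\delta>0$ and $(\alpha,\beta)\in\mathscr{X}^\ast$ let $\gamma_1(r)=x_0+\frac{\delta}{2}\int_0^r\alpha(s)ds$, $\gamma_2(r)=y_0-\frac{\delta}{2}\int_0^r\beta(s)ds$, and $$\Lambda_{z_0,\delta}(\alpha,\beta)=\int_0^1\left[\partial_yP(\gamma_1(r),\gamma_2(r))\gamma_1'(r)-\partial_xP(\gamma_1(r),\gamma_2(r))\gamma_2'(r)\right]dr.$$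 For $p=(z_0,t_0)\in{\rm b}\Omega$ define $\Lambda(p,\delta)=\sup_{(\alpha,\beta)\in\mathscr{X}^\ast}|\Lambda_{z_0,\delta}(\alpha,\beta)|$ (independent of $t_0$). A uniform global structure (UGS) of ${\rm b}\Omega$ is a pair $(f(\delta),\delta_0)$ with $\delta_0>0$ and $f:[\delta_0,\infty)\to[0,\infty)$ such that $\Lambda(p,\delta)\approx f(\delta)$ for all $p\in{\rm b}\Omega$ and $\delta\ge\delta_0$, i.e. each side is bounded by a constant times the other, with constants independent of $p$ and $\delta$. *)

theory Defs
  imports "HOL-Analysis.Analysis"
begin

definition partial_x :: "(complex \<Rightarrow> real) \<Rightarrow> complex \<Rightarrow> real" where
  "partial_x u z = frechet_derivative u (at z) 1"

definition partial_y :: "(complex \<Rightarrow> real) \<Rightarrow> complex \<Rightarrow> real" where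
  "partial_y u z = frechet_derivative u (at z) \<i>"

text \<open>Being of class \<open>C\<^sup>k\<close> in the real sense, on all of the plane.\<close>

primrec Ck :: "nat \<Rightarrow> (complex \<Rightarrow> real) \<Rightarrow> bool" where
  "Ck 0 u \<longleftrightarrow> continuous_on UNIV u"
| "Ck (Suc k) u \<longleftrightarrow> u differentiable_on UNIV \<and> Ck k (partial_x u) \<and> Ck k (partial_y u)"

definition smooth :: "(complex \<Rightarrow> real) \<Rightarrow> bool" where
  "smooth u \<longleftrightarrow> (\<forall>k. Ck k u)"

definition harmonic :: "(complex \<Rightarrow> real) \<Rightarrow> bool" where
  "harmonic u \<longleftrightarrow>
     Ck 2 u \<and> (\<forall>z. partial_x (partial_x u) z + partial_y (partial_y u) z = 0)"

text \<open>Sub-mean-value property over all circles. Only real-valued continuous functions are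
  considered, so upper semicontinuity is replaced by continuity.\<close>

definition subharmonic :: "(complex \<Rightarrow> real) \<Rightarrow> bool" where
  "subharmonic u \<longleftrightarrow> continuous_on UNIV u \<and>
     (\<forall>z. \<forall>r>0. u z \<le> 1 / (2 * pi) * integral {0..2 * pi} (\<lambda>\<theta>. u (z + of_real r * cis \<theta>)))"

definition Omega :: "(complex \<Rightarrow> real) \<Rightarrow> (complex \<times> complex) set" where
  "Omega P = {(z1, z2). Im z2 > P z1}"

definition smooth_on_interval :: "real \<Rightarrow> real \<Rightarrow> (real \<Rightarrow> real) \<Rightarrow> bool" where
  "smooth_on_interval a b f \<longleftrightarrow> (\<forall>k. \<forall>s\<in>{a<..<b}. (deriv ^^ k) f differentiable (at s))"

text \<open>Elements of \<open>FPWS\<close> are represented by total functions whose values outside \<open>{0..1}\<close>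
  are unconstrained; the quantities below depend only on the restriction to \<open>{0..1}\<close>.
  The values at the breakpoints are arbitrary.\<close>

definition FPWS :: "(real \<Rightarrow> real) set" where
  "FPWS = {f. \<exists>N (a :: nat \<Rightarrow> real). a 0 = 0 \<and> a (Suc N) = 1 \<and>
     (\<forall>i\<le>N. a i < a (Suc i) \<and> smooth_on_interval (a i) (a (Suc i)) f \<and>
        (\<exists>g. continuous_on {a i..a (Suc i)} g \<and> (\<forall>s\<in>{a i<..<a (Suc i)}. g s = f s)))}"

definition Xstar :: "((real \<Rightarrow> real) \<times> (real \<Rightarrow> real)) set" where
  "Xstar = {(\<alpha>, \<beta>). \<alpha> \<in> FPWS \<and> \<beta> \<in> FPWS \<and>
     (\<forall>s\<in>{0..1}. \<bar>\<alpha> s\<bar>\<^sup>2 + \<bar>\<beta> s\<bar>\<^sup>2 < 1) \<and>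
     integral {0..1} \<alpha> = 0 \<and> integral {0..1} \<beta> = 0}"

definition gamma1 :: "complex \<Rightarrow> real \<Rightarrow> (real \<Rightarrow> real) \<Rightarrow> real \<Rightarrow> real" where
  "gamma1 z0 \<delta> \<alpha> r = Re z0 + \<delta> / 2 * integral {0..r} \<alpha>"

definition gamma2 :: "complex \<Rightarrow> real \<Rightarrow> (real \<Rightarrow> real) \<Rightarrow> real \<Rightarrow> real" where
  "gamma2 z0 \<delta> \<beta> r = Im z0 - \<delta> / 2 * integral {0..r} \<beta>"

text \<open>The derivatives of \<open>gamma1\<close> and \<open>gamma2\<close> may fail to exist at finitely many points,
  which does not affect the integral.\<close>

definition Lambda_curve ::
  "(complex \<Rightarrow> real) \<Rightarrow> complex \<Rightarrow> real \<Rightarrow> (real \<Rightarrow> real) \<Rightarrow> (real \<Rightarrow> real) \<Rightarrow> real" where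
  "Lambda_curve P z0 \<delta> \<alpha> \<beta> = integral {0..1} (\<lambda>r.
      partial_y P (Complex (gamma1 z0 \<delta> \<alpha> r) (gamma2 z0 \<delta> \<beta> r)) * deriv (gamma1 z0 \<delta> \<alpha>) r
    - partial_x P (Complex (gamma1 z0 \<delta> \<alpha> r) (gamma2 z0 \<delta> \<beta> r)) * deriv (gamma2 z0 \<delta> \<beta>) r)"

text \<open>A point \<open>p\<close> of \<open>frontier (Omega P)\<close> has the form \<open>(z0, t0 + \<i> * P z0)\<close>, so the
  coordinate \<open>z0\<close> of \<open>p \<sim> (z0, t0)\<close> is \<open>fst p\<close>. The supremum is taken in the extended reals.\<close>

definition Lambda :: "(complex \<Rightarrow> real) \<Rightarrow> complex \<times> complex \<Rightarrow> real \<Rightarrow> ereal" where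
  "Lambda P p \<delta> = (SUP (\<alpha>, \<beta>)\<in>Xstar. ereal \<bar>Lambda_curve P (fst p) \<delta> \<alpha> \<beta>\<bar>)"

definition uniform_global_structure ::
  "(complex \<Rightarrow> real) \<Rightarrow> (real \<Rightarrow> real) \<Rightarrow> real \<Rightarrow> bool" where
  "uniform_global_structure P f \<delta>0 \<longleftrightarrow> \<delta>0 > 0 \<and> (\<forall>\<delta>\<ge>\<delta>0. f \<delta> \<ge> 0) \<and>
     (\<exists>A>0. \<exists>B>0. \<forall>p\<in>frontier (Omega P). \<forall>\<delta>\<ge>\<delta>0.
        Lambda P p \<delta> \<le> ereal (A * f \<delta>) \<and> ereal (f \<delta>) \<le> ereal B * Lambda P p \<delta>)"

end

theory Submission
  imports Defs "HOL-Complex_Analysis.Contour_Integration"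
begin

text \<open>The number attached to a pair \<open>(\<alpha>, \<beta>)\<close> is the integral of the 1-form
  \<open>\<omega> = P\<^sub>y dx - P\<^sub>x dy\<close> around a closed curve through \<open>z0\<close> of speed below \<open>\<delta>/2\<close>, and
  \<open>d\<omega> = - \<Delta>P dx dy\<close>. So \<open>\<Lambda>(p, \<delta>)\<close> measures how much Laplacian mass, counted with
  multiplicity, a loop of length about \<open>\<delta>\<close> can enclose near \<open>p\<close>.

  Lower bound: as \<open>P\<close> is not harmonic, there is a point where \<open>\<Delta>P \<noteq> 0\<close>, and by Taylor's
  formula a sufficiently small circle around it has a nonzero integral of \<open>\<omega>\<close>. A curve of length
  about \<open>\<delta>\<close> can run around this fixed circle about \<open>\<delta>\<close> times, so \<open>\<Lambda>(p, \<delta>)\<close> grows at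
  least linearly at one suitable \<open>p\<close> (lemma \<open>Lambda_linear_lower_bound\<close>). One \<open>p\<close> is
  enough, because up to a constant \<open>f\<close> dominates \<open>\<Lambda>(p, \<cdot>)\<close> for every \<open>p\<close>.

  Upper bound: the uniform structure at the single scale \<open>\<delta>0\<close> bounds the integral of \<open>\<omega>\<close>
  over every small loop, wherever it is, by one constant. A loop of scale \<open>\<delta>\<close> is the boundary of
  the cone over it with apex \<open>z0\<close>; cutting the cone into a \<open>K \<times> K\<close> grid with
  \<open>K \<approx> \<delta>/\<delta>0\<close> makes every cell boundary a small loop, the interior edges cancel, and at most
  \<open>K\<^sup>2\<close> times the constant remains (lemmas \<open>contour_integral_loop_le_grid\<close> and
  \<open>Lambda_quadratic_upper_bound\<close>).

  The cell boundaries and the circles must themselves come from pairs in \<open>Xstar\<close>. This is why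
  \<open>FPWS\<close> is shown to be closed under affine reparametrization, including reversal, and under
  concatenation, and why the invariant is rewritten as a contour integral, which behaves well under
  joining, reversing and restricting paths.\<close>

section \<open>Piecewise smooth functions\<close>

text \<open>The derivative of order \<open>k\<close> is the value of \<open>deriv\<close>, which is arbitrary where no derivative
  exists. The chain rule therefore cannot be iterated pointwise; the induction needs the formula on a
  whole neighbourhood, which is why smoothness is assumed on an open set.\<close>
lemma deriv_funpow_affine:
  fixes f :: "real \<Rightarrow> real"
  assumes "open U" and f: "\<And>k s. s \<in> U \<Longrightarrow> (deriv ^^ k) f differentiable (at s)"
    and "m * s + b \<in> U"
  shows "((deriv ^^ k) (\<lambda>r. c * f (m * r + b)) has_real_derivative
           c * m ^ Suc k * (deriv ^^ Suc k) f (m * s + b)) (at s)"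
  using assms(3)
proof (induction k arbitrary: s)
  have chain: "((\<lambda>r. a * (deriv ^^ k) f (m * r + b)) has_real_derivative
      a * ((deriv ^^ Suc k) f (m * s + b) * m)) (at s)"
    if "m * s + b \<in> U" for a k s
  proof -
    have "((deriv ^^ k) f has_real_derivative (deriv ^^ Suc k) f (m * s + b)) (at (m * s + b))"
      using f[OF that, of k] by (simp add: DERIV_deriv_iff_real_differentiable)
    moreover have "((\<lambda>r. m * r + b) has_real_derivative m) (at s)"
      by (auto intro!: derivative_eq_intros)
    ultimately have "((\<lambda>r. (deriv ^^ k) f (m * r + b)) has_real_derivative
        (deriv ^^ Suc k) f (m * s + b) * m) (at s)"
      by (rule DERIV_chain2)
    from DERIV_cmult[OF this] show ?thesis .
  qed
  case 0
  from chain[OF this, of c 0] show ?case by (simp add: algebra_simps)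
  case (Suc k)
  have "open ((\<lambda>r. m * r + b) -` U)"
    by (intro open_vimage \<open>open U\<close> continuous_intros)
  then have "\<forall>\<^sub>F r in nhds s. m * r + b \<in> U"
    using Suc.prems by (auto simp: eventually_nhds)
  then have "\<forall>\<^sub>F r in nhds s. (deriv ^^ Suc k) (\<lambda>r. c * f (m * r + b)) r
      = (c * m ^ Suc k) * (deriv ^^ Suc k) f (m * r + b)"
    by eventually_elim (use Suc.IH DERIV_imp_deriv in fastforce)
  then show ?case
    using chain[OF Suc.prems, of "c * m ^ Suc k" "Suc k"]
    by (subst DERIV_cong_ev[OF refl _ refl]) (auto simp: algebra_simps)
qed

lemma deriv_funpow_cong_ev:
  fixes f g :: "real \<Rightarrow> real"
  assumes "\<forall>\<^sub>F x in nhds s. f x = g x"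
  shows "\<forall>\<^sub>F x in nhds s. (deriv ^^ k) f x = (deriv ^^ k) g x"
proof (induction k)
  case (Suc k)
  from Suc have "\<forall>\<^sub>F x in nhds s. \<forall>\<^sub>F y in nhds x. (deriv ^^ k) f y = (deriv ^^ k) g y"
    by (simp add: eventually_eventually)
  then show ?case
    by eventually_elim (simp add: deriv_cong_ev)
qed (use assms in simp)

lemma deriv_funpow_differentiable_cong_ev:
  fixes f g :: "real \<Rightarrow> real"
  assumes "\<forall>\<^sub>F x in nhds s. f x = g x" and "(deriv ^^ k) g differentiable (at s)"
  shows "(deriv ^^ k) f differentiable (at s)"
  using DERIV_cong_ev[OF refl deriv_funpow_cong_ev[OF assms(1), of k] refl] assms(2)
  by (auto simp: real_differentiable_def)

text \<open>Ordered partitions are awkward to refine, concatenate and reverse. A finite exceptional set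
  together with one-sided limits carries the same information and is local, so that closure under
  these operations can be checked point by point.\<close>

definition piecewise_smooth :: "(real \<Rightarrow> real) \<Rightarrow> bool" where
  "piecewise_smooth f \<longleftrightarrow>
     (\<exists>S. finite S \<and> (\<forall>s\<in>{0<..<1} - S. \<forall>k. (deriv ^^ k) f differentiable (at s))) \<and>
     (\<forall>s\<in>{0..<1}. \<exists>l. (f \<longlongrightarrow> l) (at_right s)) \<and>
     (\<forall>s\<in>{0<..1}. \<exists>l. (f \<longlongrightarrow> l) (at_left s))"

lemma partition_left:
  fixes a :: "nat \<Rightarrow> real"
  assumes "a 0 \<le> s" "s < a (Suc N)"
  shows "\<exists>i\<le>N. a i \<le> s \<and> s < a (Suc i)"
  using assms
proof (induction N)
  case (Suc N)
  then show ?case by (cases "s < a (Suc N)") (auto intro: le_SucI)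
qed auto

lemma partition_right:
  fixes a :: "nat \<Rightarrow> real"
  assumes "a 0 < s" "s \<le> a (Suc N)"
  shows "\<exists>i\<le>N. a i < s \<and> s \<le> a (Suc i)"
  using assms
proof (induction N)
  case (Suc N)
  then show ?case by (cases "s \<le> a (Suc N)") (auto intro: le_SucI)
qed auto

lemma FPWS_imp_piecewise_smooth:
  assumes "f \<in> FPWS"
  shows "piecewise_smooth f"
proof -
  obtain N a where a: "a 0 = 0" "a (Suc N) = 1"
    and sm: "\<And>i. i \<le> N \<Longrightarrow> smooth_on_interval (a i) (a (Suc i)) f"
    and ext: "\<And>i. i \<le> N \<Longrightarrow> \<exists>g. continuous_on {a i..a (Suc i)} g \<and> (\<forall>s\<in>{a i<..<a (Suc i)}. g s = f s)"
    using assms unfolding FPWS_def by blast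
  have "finite (a ` {..Suc N})" by simp
  moreover have "(deriv ^^ k) f differentiable (at s)" if s: "s \<in> {0<..<1} - a ` {..Suc N}" for s k
  proof -
    obtain i where i: "i \<le> N" "a i \<le> s" "s < a (Suc i)"
      using partition_left[of a s N] a s by auto
    with s have "a i \<noteq> s" by auto
    with i sm[OF i(1)] show ?thesis by (auto simp: smooth_on_interval_def)
  qed
  moreover have "\<exists>l. (f \<longlongrightarrow> l) (at_right s)" if s: "s \<in> {0..<1}" for s
  proof -
    obtain i where i: "i \<le> N" "a i \<le> s" "s < a (Suc i)"
      using partition_left[of a s N] a s by auto
    obtain g where g: "continuous_on {a i..a (Suc i)} g" "\<forall>s\<in>{a i<..<a (Suc i)}. g s = f s"
      using ext[OF i(1)] by auto
    have "continuous_on {s..a (Suc i)} g"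
      using g(1) by (rule continuous_on_subset) (use i in auto)
    then have "(g \<longlongrightarrow> g s) (at_right s)"
      by (rule continuous_on_Icc_at_rightD) (use i in auto)
    moreover have "\<forall>\<^sub>F x in at_right s. g x = f x"
      using eventually_at_right_real[OF i(3)] by eventually_elim (use i g(2) in auto)
    ultimately show ?thesis using tendsto_cong by fast
  qed
  moreover have "\<exists>l. (f \<longlongrightarrow> l) (at_left s)" if s: "s \<in> {0<..1}" for s
  proof -
    obtain i where i: "i \<le> N" "a i < s" "s \<le> a (Suc i)"
      using partition_right[of a s N] a s by auto
    obtain g where g: "continuous_on {a i..a (Suc i)} g" "\<forall>s\<in>{a i<..<a (Suc i)}. g s = f s"
      using ext[OF i(1)] by auto
    have "continuous_on {a i..s} g"
      using g(1) by (rule continuous_on_subset) (use i in auto)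
    then have "(g \<longlongrightarrow> g s) (at_left s)"
      by (rule continuous_on_Icc_at_leftD) (use i in auto)
    moreover have "\<forall>\<^sub>F x in at_left s. g x = f x"
      using eventually_at_left_real[OF i(2)] by eventually_elim (use i g(2) in auto)
    ultimately show ?thesis using tendsto_cong by fast
  qed
  ultimately show ?thesis unfolding piecewise_smooth_def by blast
qed

lemma piecewise_smooth_imp_FPWS:
  assumes "piecewise_smooth f"
  shows "f \<in> FPWS"
proof -
  obtain S where "finite S"
    and S: "\<And>s k. s \<in> {0<..<1} - S \<Longrightarrow> (deriv ^^ k) f differentiable (at s)"
    and R: "\<And>s. s \<in> {0..<1} \<Longrightarrow> \<exists>l. (f \<longlongrightarrow> l) (at_right s)"
    and L: "\<And>s. s \<in> {0<..1} \<Longrightarrow> \<exists>l. (f \<longlongrightarrow> l) (at_left s)"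
    using assms unfolding piecewise_smooth_def by blast
  \<comment> \<open>The breakpoints are the exceptional points inside the interval and the two ends, listed in
    increasing order; between neighbours there is no exceptional point.\<close>
  define T where "T = S \<inter> {0<..<1} \<union> {0, 1}"
  have T: "finite T" "0 \<in> T" "1 \<in> T" "T \<subseteq> {0..1}"
    using \<open>finite S\<close> by (auto simp: T_def)
  define xs where "xs = sorted_list_of_set T"
  have xs: "set xs = T" "sorted_wrt (<) xs"
    using T by (auto simp: xs_def strict_sorted_list_of_set)
  have less: "xs ! i < xs ! j" if "i < j" "j < length xs" for i j
    using sorted_wrt_nth_less[OF xs(2) that] .
  have "card T \<ge> card {0, 1::real}"
    using T by (intro card_mono) auto
  moreover have "length xs = card T"
    unfolding xs_def by (simp add: T)
  ultimately have "length xs \<ge> 2" by simp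
  then obtain N where N: "length xs = Suc (Suc N)"
    by (metis Suc_le_D numeral_2_eq_2 Suc_le_mono)
  have mem: "xs ! i \<in> T" if "i < length xs" for i
    using that xs(1) by auto
  have first: "xs ! 0 = 0"
  proof -
    obtain j where j: "j < length xs" "xs ! j = 0"
      using T(2) xs(1) by (metis in_set_conv_nth)
    have "xs ! 0 \<ge> 0" using mem[of 0] N T(4) by auto
    then show ?thesis using less[of 0 j] j by (cases j) auto
  qed
  have last: "xs ! Suc N = 1"
  proof -
    obtain j where j: "j < length xs" "xs ! j = 1"
      using T(3) xs(1) by (metis in_set_conv_nth)
    have "xs ! Suc N \<le> 1" using mem[of "Suc N"] N T(4) by auto
    then show ?thesis using less[of j "Suc N"] j N by (cases "j = Suc N") auto
  qed
  have gap: "s \<in> {0<..<1} - S" if "i \<le> N" "xs ! i < s" "s < xs ! Suc i" for i s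
  proof -
    have "s \<notin> T"
    proof
      assume "s \<in> T"
      then obtain j where j: "j < length xs" "xs ! j = s"
        using xs(1) by (metis in_set_conv_nth)
      have "\<not> j \<le> i" using j that N less[of j i] by (cases "j = i") auto
      moreover have "\<not> j \<ge> Suc i" using j that N less[of "Suc i" j] by (cases "j = Suc i") auto
      ultimately show False by simp
    qed
    moreover have "0 \<le> xs ! i" "xs ! Suc i \<le> 1"
      using mem[of i] mem[of "Suc i"] N T(4) that by auto
    ultimately show ?thesis using that by (auto simp: T_def)
  qed
  show ?thesis unfolding FPWS_def mem_Collect_eq
  proof (intro exI[of _ N] exI[of _ "\<lambda>i. xs ! i"] conjI allI impI)
    fix i assume i: "i \<le> N"
    show lt: "xs ! i < xs ! Suc i" using less i N by auto
    show "smooth_on_interval (xs ! i) (xs ! Suc i) f"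
      using S gap[OF i] by (auto simp: smooth_on_interval_def)
    have bnd: "0 \<le> xs ! i" "xs ! Suc i \<le> 1"
      using mem[of i] mem[of "Suc i"] N T(4) i by auto
    define u v where "u = xs ! i" and "v = xs ! Suc i"
    have cont: "f \<midarrow>s\<rightarrow> f s" if "u < s" "s < v" for s
      using S[of s 0] gap[OF i] that
      by (auto simp: u_def v_def dest!: differentiable_imp_continuous_within isContD)
    obtain l where l: "(f \<longlongrightarrow> l) (at_right u)"
      using R[of u] lt bnd by (auto simp: u_def v_def)
    obtain l' where l': "(f \<longlongrightarrow> l') (at_left v)"
      using L[of v] lt bnd by (auto simp: u_def v_def)
    define g where "g s = (if s \<le> u then l else if s \<ge> v then l' else f s)" for s
    have "u < v" using lt by (simp add: u_def v_def)
    have "continuous_on {u..v} g"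
    proof (rule continuous_on_IccI)
      have "\<forall>\<^sub>F s in at_right u. f s = g s"
        using eventually_at_right_real[OF \<open>u < v\<close>] by eventually_elim (auto simp: g_def)
      with l have "(g \<longlongrightarrow> l) (at_right u)" using tendsto_cong by fast
      then show "(g \<longlongrightarrow> g u) (at_right u)" by (simp add: g_def)
      have "\<forall>\<^sub>F s in at_left v. f s = g s"
        using eventually_at_left_real[OF \<open>u < v\<close>] by eventually_elim (auto simp: g_def)
      with l' have "(g \<longlongrightarrow> l') (at_left v)" using tendsto_cong by fast
      then show "(g \<longlongrightarrow> g v) (at_left v)" using \<open>u < v\<close> by (simp add: g_def)
      show "g \<midarrow>s\<rightarrow> g s" if s: "u < s" "s < v" for s
      proof -
        have "\<forall>\<^sub>F t in at s. f t = g t"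
          using eventually_at_in_open'[of "{u<..<v}" s] s by (auto elim: eventually_mono simp: g_def)
        with cont[OF s] have "g \<midarrow>s\<rightarrow> f s" using tendsto_cong by fast
        then show ?thesis using s by (simp add: g_def)
      qed
    qed fact
    moreover have "\<forall>s\<in>{u<..<v}. g s = f s" by (simp add: g_def)
    ultimately show "\<exists>g. continuous_on {xs ! i..xs ! Suc i} g \<and>
        (\<forall>s\<in>{xs ! i<..<xs ! Suc i}. g s = f s)" unfolding u_def v_def by blast
  qed (use first last in auto)
qed

lemma FPWS_iff_piecewise_smooth: "f \<in> FPWS \<longleftrightarrow> piecewise_smooth f"
  using FPWS_imp_piecewise_smooth piecewise_smooth_imp_FPWS by blast

lemma FPWS_smooth:
  assumes "\<And>k s. (deriv ^^ k) f differentiable (at s)"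
  shows "f \<in> FPWS"
proof -
  have "(f \<longlongrightarrow> f s) (at s within A)" for s A
    using assms[of 0 s] by (auto dest!: differentiable_imp_continuous_within
        intro: tendsto_within_subset[of _ _ _ UNIV] simp: continuous_within)
  then show ?thesis unfolding FPWS_iff_piecewise_smooth piecewise_smooth_def
    using assms by blast
qed

lemma FPWS_const: "(\<lambda>_. c) \<in> FPWS"
proof (rule FPWS_smooth)
  fix k and s :: real
  have "(deriv ^^ k) (\<lambda>_. c) = (\<lambda>_. if k = 0 then c else 0)"
    by (induction k) auto
  then show "(deriv ^^ k) (\<lambda>_. c) differentiable (at s)" by simp
qed

lemma filterlim_affine_one_sided:
  fixes m b s :: real
  assumes "m > 0"
  shows "filterlim (\<lambda>r. m * r + b) (at_right (m * s + b)) (at_right s)"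
    and "filterlim (\<lambda>r. m * r + b) (at_left (m * s + b)) (at_left s)"
    and "filterlim (\<lambda>r. - m * r + b) (at_left (- m * s + b)) (at_right s)"
    and "filterlim (\<lambda>r. - m * r + b) (at_right (- m * s + b)) (at_left s)"
  using assms
  by (auto simp: filterlim_at eventually_at_filter intro!: tendsto_eq_intros always_eventually)

text \<open>A negative slope exchanges left and right limits. The endpoints of the unit interval carry only
  one-sided information, but an affine map into the interval can only send an end to an end of the
  correct orientation or to an interior point.\<close>
lemma FPWS_affine:
  assumes "f \<in> FPWS" and "m \<noteq> 0" and maps: "\<And>r. r \<in> {0..1} \<Longrightarrow> m * r + b \<in> {0..1}"
  shows "(\<lambda>r. c * f (m * r + b)) \<in> FPWS"
proof -
  obtain S where "finite S"
    and S: "\<And>s k. s \<in> {0<..<1} - S \<Longrightarrow> (deriv ^^ k) f differentiable (at s)"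
    and R: "\<And>s. s \<in> {0..<1} \<Longrightarrow> \<exists>l. (f \<longlongrightarrow> l) (at_right s)"
    and L: "\<And>s. s \<in> {0<..1} \<Longrightarrow> \<exists>l. (f \<longlongrightarrow> l) (at_left s)"
    using assms(1) unfolding FPWS_iff_piecewise_smooth piecewise_smooth_def by blast
  have ends: "b \<in> {0..1}" "m + b \<in> {0..1}"
    using maps[of 0] maps[of 1] by auto
  \<comment> \<open>An affine map of the unit interval into itself sends interior points to interior points.\<close>
  have pos: "0 < m * s + b" if "0 < s" "s < 1" for s
  proof (cases "m > 0")
    case True
    then have "0 < m * s" using that by simp
    then show ?thesis using ends by simp
  next
    case False
    then have "m * s > m" using that assms(2) by (simp add: mult_less_cancel_left1)
    then show ?thesis using ends by simp
  qed
  have less1: "m * s + b < 1" if "0 < s" "s < 1" for s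
  proof (cases "m > 0")
    case True
    then have "m * s < m" using that by simp
    then show ?thesis using ends by simp
  next
    case False
    then have "m * s < 0" using that assms(2) by (simp add: mult_less_0_iff)
    then show ?thesis using ends by simp
  qed
  have "finite ((\<lambda>s. m * s + b) -` S)"
    using \<open>finite S\<close> assms(2) by (intro finite_vimageI) (auto simp: inj_def)
  moreover have "(deriv ^^ k) (\<lambda>r. c * f (m * r + b)) differentiable (at s)"
    if "s \<in> {0<..<1} - (\<lambda>s. m * s + b) -` S" for s k
  proof -
    have "open ({0<..<1} - S)" using \<open>finite S\<close> by (simp add: open_Diff finite_imp_closed)
    from deriv_funpow_affine[OF this S, where s = s and m = m and b = b] show ?thesis
      using that pos less1 by (auto simp: real_differentiable_def)
  qed
  moreover have "\<exists>l. ((\<lambda>r. c * f (m * r + b)) \<longlongrightarrow> l) (at_right s)" if s: "s \<in> {0..<1}" for s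
  proof (cases "m > 0")
    case True
    then have "m * s < m" using s by simp
    then have "m * s + b \<in> {0..<1}" using maps[of s] ends s by auto
    from R[OF this] obtain l where "(f \<longlongrightarrow> l) (at_right (m * s + b))" by auto
    from filterlim_compose[OF this filterlim_affine_one_sided(1)[OF True]]
    show ?thesis by (auto intro!: tendsto_mult_left)
  next
    case False
    then have m: "- m > 0" using assms(2) by simp
    then have "m * s > m" using s by (simp add: mult_less_cancel_left1)
    then have "m * s + b \<in> {0<..1}" using maps[of s] ends s by auto
    from L[OF this] obtain l where "(f \<longlongrightarrow> l) (at_left (m * s + b))" by auto
    from filterlim_compose[OF this filterlim_affine_one_sided(3)[OF m, of b s, simplified]]
    show ?thesis by (auto intro!: tendsto_mult_left)
  qed
  moreover have "\<exists>l. ((\<lambda>r. c * f (m * r + b)) \<longlongrightarrow> l) (at_left s)" if s: "s \<in> {0<..1}" for s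
  proof (cases "m > 0")
    case True
    then have "m * s > 0" using s by simp
    then have "m * s + b \<in> {0<..1}" using maps[of s] ends s by auto
    from L[OF this] obtain l where "(f \<longlongrightarrow> l) (at_left (m * s + b))" by auto
    from filterlim_compose[OF this filterlim_affine_one_sided(2)[OF True]]
    show ?thesis by (auto intro!: tendsto_mult_left)
  next
    case False
    then have m: "- m > 0" using assms(2) by simp
    then have "m * s < 0" using s by (simp add: mult_less_0_iff)
    then have "m * s + b \<in> {0..<1}" using maps[of s] ends s by auto
    from R[OF this] obtain l where "(f \<longlongrightarrow> l) (at_right (m * s + b))" by auto
    from filterlim_compose[OF this filterlim_affine_one_sided(4)[OF m, of b s, simplified]]
    show ?thesis by (auto intro!: tendsto_mult_left)
  qed
  ultimately show ?thesis unfolding FPWS_iff_piecewise_smooth piecewise_smooth_def by blast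
qed

lemma FPWS_cmult: "f \<in> FPWS \<Longrightarrow> (\<lambda>r. c * f r) \<in> FPWS"
  using FPWS_affine[of f 1 0 c] by simp

text \<open>This is the velocity of the concatenation of two curves, each traversed at double speed on half
  of the parameter interval.\<close>
lemma FPWS_join:
  assumes "f \<in> FPWS" "g \<in> FPWS"
  shows "(\<lambda>r. if r \<le> 1/2 then 2 * f (2 * r) else 2 * g (2 * r - 1)) \<in> FPWS" (is "?h \<in> _")
proof -
  obtain S where S: "finite S" "\<And>s k. s \<in> {0<..<1} - S \<Longrightarrow> (deriv ^^ k) f differentiable (at s)"
    and Rf: "\<And>s. s \<in> {0..<1} \<Longrightarrow> \<exists>l. (f \<longlongrightarrow> l) (at_right s)"
    and Lf: "\<And>s. s \<in> {0<..1} \<Longrightarrow> \<exists>l. (f \<longlongrightarrow> l) (at_left s)"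
    using assms(1) unfolding FPWS_iff_piecewise_smooth piecewise_smooth_def by blast
  obtain T where T: "finite T" "\<And>s k. s \<in> {0<..<1} - T \<Longrightarrow> (deriv ^^ k) g differentiable (at s)"
    and Rg: "\<And>s. s \<in> {0..<1} \<Longrightarrow> \<exists>l. (g \<longlongrightarrow> l) (at_right s)"
    and Lg: "\<And>s. s \<in> {0<..1} \<Longrightarrow> \<exists>l. (g \<longlongrightarrow> l) (at_left s)"
    using assms(2) unfolding FPWS_iff_piecewise_smooth piecewise_smooth_def by blast
  define U where "U = (\<lambda>r. 2 * r) -` S \<union> (\<lambda>r. 2 * r + -1) -` T \<union> {1/2}"
  have "finite U"
    unfolding U_def using S(1) T(1) by (auto intro!: finite_vimageI simp: inj_def)
  moreover have "(deriv ^^ k) ?h differentiable (at s)" if s: "s \<in> {0<..<1} - U" for s k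
  proof (cases "s < 1/2")
    case True
    have o: "open ({0<..<1} - S)" using \<open>finite S\<close> by (simp add: open_Diff finite_imp_closed)
    have "(deriv ^^ k) (\<lambda>r. 2 * f (2 * r + 0)) differentiable (at s)"
      using deriv_funpow_affine[OF o S(2), where s = s and m = 2 and b = 0] True s
      by (auto simp: real_differentiable_def U_def)
    moreover have "\<forall>\<^sub>F r in nhds s. ?h r = 2 * f (2 * r + 0)"
      using eventually_nhds_in_open[of "{..<1/2}" s] True by (auto elim: eventually_mono)
    ultimately show ?thesis by (rule deriv_funpow_differentiable_cong_ev[rotated])
  next
    case False
    then have False: "s > 1/2" using s by (auto simp: U_def)
    have o: "open ({0<..<1} - T)" using \<open>finite T\<close> by (simp add: open_Diff finite_imp_closed)
    have "(deriv ^^ k) (\<lambda>r. 2 * g (2 * r + -1)) differentiable (at s)"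
      using deriv_funpow_affine[OF o T(2), where s = s and m = 2 and b = "-1"] False s
      by (auto simp: real_differentiable_def U_def)
    moreover have "\<forall>\<^sub>F r in nhds s. ?h r = 2 * g (2 * r + -1)"
      using eventually_nhds_in_open[of "{1/2<..}" s] False by (auto elim: eventually_mono)
    ultimately show ?thesis by (rule deriv_funpow_differentiable_cong_ev[rotated])
  qed
  moreover have "\<exists>l. (?h \<longlongrightarrow> l) (at_right s)" if s: "s \<in> {0..<1}" for s
  proof (cases "s < 1/2")
    case True
    then obtain l where "(f \<longlongrightarrow> l) (at_right (2 * s + 0))" using Rf[of "2 * s + 0"] s by auto
    from filterlim_compose[OF this filterlim_affine_one_sided(1)]
    have "((\<lambda>r. 2 * f (2 * r)) \<longlongrightarrow> 2 * l) (at_right s)" by (auto intro!: tendsto_mult_left)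
    moreover have "\<forall>\<^sub>F r in at_right s. 2 * f (2 * r) = ?h r"
      using eventually_at_right_real[OF True] by eventually_elim auto
    ultimately show ?thesis using tendsto_cong by fast
  next
    case False
    then obtain l where "(g \<longlongrightarrow> l) (at_right (2 * s + -1))" using Rg[of "2 * s + -1"] s by auto
    from filterlim_compose[OF this filterlim_affine_one_sided(1)]
    have "((\<lambda>r. 2 * g (2 * r - 1)) \<longlongrightarrow> 2 * l) (at_right s)" by (auto intro!: tendsto_mult_left)
    moreover have "\<forall>\<^sub>F r in at_right s. 2 * g (2 * r - 1) = ?h r"
      unfolding eventually_at_filter using False by (intro always_eventually) auto
    ultimately show ?thesis using tendsto_cong by fast
  qed
  moreover have "\<exists>l. (?h \<longlongrightarrow> l) (at_left s)" if s: "s \<in> {0<..1}" for s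
  proof (cases "s \<le> 1/2")
    case True
    then obtain l where "(f \<longlongrightarrow> l) (at_left (2 * s + 0))" using Lf[of "2 * s + 0"] s by auto
    from filterlim_compose[OF this filterlim_affine_one_sided(2)]
    have "((\<lambda>r. 2 * f (2 * r)) \<longlongrightarrow> 2 * l) (at_left s)" by (auto intro!: tendsto_mult_left)
    moreover have "\<forall>\<^sub>F r in at_left s. 2 * f (2 * r) = ?h r"
      unfolding eventually_at_filter using True by (intro always_eventually) auto
    ultimately show ?thesis using tendsto_cong by fast
  next
    case False
    then have False: "1/2 < s" by simp
    then obtain l where "(g \<longlongrightarrow> l) (at_left (2 * s + -1))" using Lg[of "2 * s + -1"] s by auto
    from filterlim_compose[OF this filterlim_affine_one_sided(2)]
    have "((\<lambda>r. 2 * g (2 * r - 1)) \<longlongrightarrow> 2 * l) (at_left s)" by (auto intro!: tendsto_mult_left)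
    moreover have "\<forall>\<^sub>F r in at_left s. 2 * g (2 * r - 1) = ?h r"
      using eventually_at_left_real[OF False] by eventually_elim auto
    ultimately show ?thesis using tendsto_cong by fast
  qed
  ultimately show ?thesis unfolding FPWS_iff_piecewise_smooth piecewise_smooth_def by blast
qed

lemma FPWS_isCont:
  assumes "f \<in> FPWS"
  obtains S where "finite S" "\<And>s. s \<in> {0<..<1} - S \<Longrightarrow> isCont f s"
proof -
  obtain S where "finite S"
    and S: "\<And>s k. s \<in> {0<..<1} - S \<Longrightarrow> (deriv ^^ k) f differentiable (at s)"
    using assms unfolding FPWS_iff_piecewise_smooth piecewise_smooth_def by blast
  then have "isCont f s" if "s \<in> {0<..<1} - S" for s
    using S[OF that, of 0] by (simp add: differentiable_imp_continuous_within)
  with \<open>finite S\<close> that show ?thesis by blast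
qed

lemma integrable_mult_FPWS:
  fixes h :: "real \<Rightarrow> complex"
  assumes "f \<in> FPWS" "continuous_on {0..1} h"
  shows "(\<lambda>s. h s * of_real (f s)) integrable_on {0..1}"
proof -
  obtain N a where a: "a 0 = 0" "a (Suc N) = 1"
    and less: "\<And>i. i \<le> N \<Longrightarrow> a i < a (Suc i)"
    and ext: "\<And>i. i \<le> N \<Longrightarrow> \<exists>g. continuous_on {a i..a (Suc i)} g \<and> (\<forall>s\<in>{a i<..<a (Suc i)}. g s = f s)"
    using assms(1) unfolding FPWS_def by blast
  \<comment> \<open>Counting down from the last breakpoint shows that none of them exceeds 1.\<close>
  have le1: "a (Suc N - i) \<le> 1" if "i \<le> Suc N" for i
    using that
  proof (induction i)
    case (Suc i)
    then show ?case using less[of "N - i"] by (simp add: Suc_diff_le)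
  qed (simp add: a)
  have "0 \<le> a i \<and> (\<lambda>s. h s * of_real (f s)) integrable_on {0..a i}" if "i \<le> Suc N" for i
    using that
  proof (induction i)
    case 0
    then show ?case using integrable_on_refl[of _ "0::real"] by (simp add: a)
  next
    case (Suc i)
    then have i: "i \<le> N" by simp
    obtain g where g: "continuous_on {a i..a (Suc i)} g" "\<forall>s\<in>{a i<..<a (Suc i)}. g s = f s"
      using ext[OF i] by auto
    have "N - i \<le> Suc N" by simp
    then have "continuous_on {a i..a (Suc i)} h"
      using assms(2) le1[of "N - i"] Suc i by (auto elim!: continuous_on_subset simp: Suc_diff_le)
    then have "(\<lambda>s. h s * of_real (g s)) integrable_on {a i..a (Suc i)}"
      by (intro integrable_continuous_real continuous_intros g)
    then have "(\<lambda>s. h s * of_real (f s)) integrable_on {a i..a (Suc i)}"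
      by (rule integrable_spike_finite[of "{a i, a (Suc i)}", rotated 2]) (use g(2) in auto)
    with Suc less[OF i] show ?case
      by (auto intro: Henstock_Kurzweil_Integration.integrable_combine[where c = "a i"])
  qed
  from this[of "Suc N"] show ?thesis by (simp add: a)
qed

section \<open>Curves with piecewise smooth velocity\<close>

text \<open>Determining \<open>g\<close> by continuity and by its derivative off a finite set, rather than as an
  indefinite integral of \<open>d\<close>, lets the closure properties below be proved by differentiation alone;
  the fundamental theorem of calculus recovers the integral.\<close>
definition velocity :: "(real \<Rightarrow> complex) \<Rightarrow> (real \<Rightarrow> complex) \<Rightarrow> bool" where
  "velocity d g \<longleftrightarrow> (\<lambda>s. Re (d s)) \<in> FPWS \<and> (\<lambda>s. Im (d s)) \<in> FPWS \<and> continuous_on {0..1} g \<and>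
     (\<exists>S. finite S \<and> (\<forall>s\<in>{0<..<1} - S. (g has_vector_derivative d s) (at s)))"

text \<open>The closed curves of speed below \<open>\<delta>/2\<close> are those described by \<open>Xstar\<close> at scale
  \<open>\<delta>\<close>. The condition bounds the speed and not the length, so concatenating two curves doubles
  the bound: each has to be run through in half the time.\<close>
definition speed_bounded :: "real \<Rightarrow> (real \<Rightarrow> complex) \<Rightarrow> bool" where
  "speed_bounded L g \<longleftrightarrow> (\<exists>d. velocity d g \<and> (\<forall>s\<in>{0..1}. norm (d s) < L))"

lemma velocity_has_integral:
  assumes "velocity d g" "0 \<le> u" "u \<le> v" "v \<le> 1"
  shows "(d has_integral g v - g u) {u..v}"
proof -
  obtain S where "finite S" "\<forall>s\<in>{0<..<1} - S. (g has_vector_derivative d s) (at s)"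
    and "continuous_on {0..1} g"
    using assms(1) by (auto simp: velocity_def)
  then show ?thesis
    using assms by (intro fundamental_theorem_of_calculus_interior_strong[of S])
      (auto elim: continuous_on_subset)
qed

lemma FPWS_parts_isCont:
  assumes "(\<lambda>s. Re (d s)) \<in> FPWS" "(\<lambda>s. Im (d s)) \<in> FPWS"
  obtains S where "finite S" "\<And>s. s \<in> {0<..<1} - S \<Longrightarrow> isCont d s"
proof -
  obtain T where T: "finite T" "\<And>s. s \<in> {0<..<1} - T \<Longrightarrow> isCont (\<lambda>s. Re (d s)) s"
    using FPWS_isCont[OF assms(1)] by metis
  obtain U where U: "finite U" "\<And>s. s \<in> {0<..<1} - U \<Longrightarrow> isCont (\<lambda>s. Im (d s)) s"
    using FPWS_isCont[OF assms(2)] by metis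
  have "isCont d s" if "s \<in> {0<..<1} - (T \<union> U)" for s
  proof -
    have "isCont (\<lambda>s. of_real (Re (d s)) + \<i> * of_real (Im (d s))) s"
      using that T(2) U(2) by (intro continuous_intros) auto
    then show ?thesis by (simp flip: complex_eq)
  qed
  with T(1) U(1) that[of "T \<union> U"] show ?thesis by blast
qed

lemma velocity_cont:
  assumes "velocity d g"
  obtains S where "finite S" "{0, 1} \<subseteq> S" "continuous_on ({0..1} - S) d"
    "\<And>s. s \<in> {0..1} - S \<Longrightarrow> (g has_vector_derivative d s) (at s)"
proof -
  obtain S where S: "finite S" "\<forall>s\<in>{0<..<1} - S. (g has_vector_derivative d s) (at s)"
    using assms by (auto simp: velocity_def)
  obtain T where T: "finite T" "\<And>s. s \<in> {0<..<1} - T \<Longrightarrow> isCont d s"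
    using assms FPWS_parts_isCont[of d] by (auto simp: velocity_def)
  define V where "V = S \<union> T \<union> {0, 1}"
  have sub: "s \<in> {0<..<1} - S \<and> s \<in> {0<..<1} - T" if "s \<in> {0..1} - V" for s
    using that by (auto simp: V_def less_le)
  then have "continuous_on ({0..1} - V) d"
    using T(2) by (intro continuous_at_imp_continuous_on) auto
  moreover have "finite V" "{0, 1} \<subseteq> V" using S T by (auto simp: V_def)
  ultimately show ?thesis using that[of V] sub S by blast
qed

lemma velocity_valid_path:
  assumes "velocity d g"
  shows "valid_path g"
proof -
  obtain S where "finite S" "continuous_on ({0..1} - S) d"
    "\<And>s. s \<in> {0..1} - S \<Longrightarrow> (g has_vector_derivative d s) (at s)"
    using velocity_cont[OF assms] by metis
  moreover have "continuous_on {0..1} g" using assms by (simp add: velocity_def)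
  ultimately show ?thesis
    unfolding valid_path_def piecewise_C1_differentiable_on_def C1_differentiable_on_def by blast
qed

lemma integrable_mult_FPWS_parts:
  assumes "(\<lambda>s. Re (d s)) \<in> FPWS" "(\<lambda>s. Im (d s)) \<in> FPWS" "continuous_on {0..1} h"
  shows "(\<lambda>s. h s * d s) integrable_on {0..1}"
proof -
  have "(\<lambda>s. h s * of_real (Re (d s)) + (h s * \<i>) * of_real (Im (d s))) integrable_on {0..1}"
    using assms by (intro integrable_add integrable_mult_FPWS continuous_intros)
  moreover have "h s * of_real (Re (d s)) + (h s * \<i>) * of_real (Im (d s)) = h s * d s" for s
    by (subst (3) complex_eq) (simp add: algebra_simps)
  ultimately show ?thesis by simp
qed

lemma has_contour_integral_velocity:
  assumes "velocity d g" "continuous_on UNIV F"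
  shows "(F has_contour_integral integral {0..1} (\<lambda>s. F (g s) * d s)) g"
    and "(\<lambda>s. F (g s) * d s) integrable_on {0..1}"
proof -
  have "continuous_on {0..1} (\<lambda>s. F (g s))"
    using assms by (auto simp: velocity_def intro: continuous_on_compose2)
  then show int: "(\<lambda>s. F (g s) * d s) integrable_on {0..1}"
    using assms(1) by (intro integrable_mult_FPWS_parts) (auto simp: velocity_def)
  obtain S where S: "finite S" "\<And>s. s \<in> {0..1} - S \<Longrightarrow> (g has_vector_derivative d s) (at s)"
    using velocity_cont[OF assms(1)] by metis
  have "((\<lambda>s. F (g s) * vector_derivative g (at s)) has_integral
      integral {0..1} (\<lambda>s. F (g s) * d s)) {0..1}"
    by (rule has_integral_spike_finite[OF S(1) _ integrable_integral[OF int]])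
      (simp add: S(2) vector_derivative_at)
  then show "(F has_contour_integral integral {0..1} (\<lambda>s. F (g s) * d s)) g"
    by (simp add: has_contour_integral)
qed

lemma speed_bounded_valid_path: "speed_bounded L g \<Longrightarrow> valid_path g"
  using velocity_valid_path speed_bounded_def by blast

lemma speed_bounded_integrable:
  "speed_bounded L g \<Longrightarrow> continuous_on UNIV F \<Longrightarrow> F contour_integrable_on g"
  using has_contour_integral_velocity(1) speed_bounded_def contour_integrable_on_def by metis

lemma speed_bounded_dist:
  assumes "speed_bounded L g" "t \<in> {0..1}"
  shows "norm (g t - g 0) \<le> L"
proof -
  obtain d where d: "velocity d g" "\<forall>s\<in>{0..1}. norm (d s) < L"
    using assms(1) by (auto simp: speed_bounded_def)
  then have "norm (d 0) < L" by simp
  then have L: "0 \<le> L" using norm_ge_zero[of "d 0"] by linarith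
  have "(d has_integral g t - g 0) (cbox 0 t)"
    using velocity_has_integral[OF d(1), of 0 t] assms(2) by simp
  from has_integral_bound[OF L this] have "norm (g t - g 0) \<le> L * t"
    using d(2) assms(2) by (force intro: less_imp_le)
  also have "\<dots> \<le> L" using assms(2) L by (simp add: mult_left_le)
  finally show ?thesis .
qed

lemma speed_bounded_mono: "speed_bounded L g \<Longrightarrow> L \<le> M \<Longrightarrow> speed_bounded M g"
  unfolding speed_bounded_def by (meson order_less_le_trans)

lemma speed_bounded_linepath:
  assumes "norm (b - a) < L"
  shows "speed_bounded L (linepath a b)"
proof -
  have "velocity (\<lambda>_. b - a) (linepath a b)"
    unfolding velocity_def
    by (auto intro!: FPWS_const exI[of _ "{}"] has_vector_derivative_linepath_within)
  with assms show ?thesis unfolding speed_bounded_def by blast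
qed

lemma speed_bounded_affine:
  assumes "speed_bounded L g" and m: "m \<noteq> 0" and maps: "\<And>r. r \<in> {0..1} \<Longrightarrow> m * r + b \<in> {0..1}"
    and c: "0 < c" "c * \<bar>m\<bar> * L \<le> M"
  shows "speed_bounded M (\<lambda>r. w + of_real c * g (m * r + b))"
proof -
  obtain d where d: "velocity d g" "\<forall>s\<in>{0..1}. norm (d s) < L"
    using assms(1) by (auto simp: speed_bounded_def)
  then obtain S where S: "finite S" "{0, 1} \<subseteq> S"
    "\<And>s. s \<in> {0..1} - S \<Longrightarrow> (g has_vector_derivative d s) (at s)"
    using velocity_cont by metis
  define e where "e r = of_real (c * m) * d (m * r + b)" for r
  have "velocity e (\<lambda>r. w + of_real c * g (m * r + b))"
    unfolding velocity_def
  proof (intro conjI exI[of _ "(\<lambda>r. m * r + b) -` S"] ballI)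
    show "(\<lambda>s. Re (e s)) \<in> FPWS" "(\<lambda>s. Im (e s)) \<in> FPWS"
      using d(1) m FPWS_affine[OF _ m maps, where c = "c * m"] by (auto simp: velocity_def e_def)
    show "continuous_on {0..1} (\<lambda>r. w + of_real c * g (m * r + b))"
    proof -
      have "continuous_on {0..1} g" using d(1) by (simp add: velocity_def)
      then have "continuous_on {0..1} (\<lambda>r. g (m * r + b))"
        by (rule continuous_on_compose2) (use maps in \<open>auto intro!: continuous_intros\<close>)
      then show ?thesis by (intro continuous_intros)
    qed
    show "finite ((\<lambda>r. m * r + b) -` S)"
      using S(1) m by (intro finite_vimageI) (auto simp: inj_def)
    fix r :: real assume r: "r \<in> {0<..<1} - (\<lambda>r. m * r + b) -` S"
    then have "m * r + b \<in> {0..1} - S" using maps[of r] by auto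
    from S(3)[OF this] have "(g has_vector_derivative d (m * r + b)) (at (m * r + b))" .
    moreover have "((\<lambda>r. m * r + b) has_vector_derivative m) (at r)"
      by (auto intro!: derivative_eq_intros simp flip: has_real_derivative_iff_has_vector_derivative)
    ultimately have "((g \<circ> (\<lambda>r. m * r + b)) has_vector_derivative m *\<^sub>R d (m * r + b)) (at r)"
      by (intro vector_diff_chain_at)
    from has_vector_derivative_add[OF has_vector_derivative_const[of w]
        has_vector_derivative_mult_right[OF this, of "of_real c"]]
    show "((\<lambda>r. w + of_real c * g (m * r + b)) has_vector_derivative e r) (at r)"
      by (simp add: e_def o_def scaleR_conv_of_real mult.assoc)
  qed
  moreover have "norm (e r) < M" if "r \<in> {0..1}" for r
  proof -
    have "norm (e r) = c * \<bar>m\<bar> * norm (d (m * r + b))"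
      using c(1) by (simp add: e_def norm_mult)
    also have "\<dots> < c * \<bar>m\<bar> * L"
      using d(2) maps[OF that] c(1) m by (intro mult_strict_left_mono) auto
    finally show ?thesis using c(2) by simp
  qed
  ultimately show ?thesis unfolding speed_bounded_def by blast
qed

lemma speed_bounded_subpath:
  assumes "speed_bounded L g" "0 \<le> u" "u < v" "v \<le> 1" "(v - u) * L \<le> M"
  shows "speed_bounded M (subpath u v g)"
proof -
  have "(v - u) * r + u \<in> {0..1}" if "r \<in> {0..1}" for r
  proof -
    have "0 \<le> (v - u) * r" "(v - u) * r \<le> v - u"
      using that assms by (auto intro: mult_left_le)
    then have "0 \<le> (v - u) * r + u" "(v - u) * r + u \<le> 1" using assms by linarith+
    then show ?thesis by simp
  qed
  from speed_bounded_affine[OF assms(1) _ this, of 1 M 0] show ?thesis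
    using assms by (simp add: subpath_def)
qed

lemma speed_bounded_reversepath:
  assumes "speed_bounded L g"
  shows "speed_bounded L (reversepath g)"
  using speed_bounded_affine[OF assms, of "-1" 1 1 L 0] by (simp add: reversepath_def)

lemma speed_bounded_join:
  assumes g1: "speed_bounded L g1" and g2: "speed_bounded L g2" and "g1 1 = g2 0"
  shows "speed_bounded (2 * L) (g1 +++ g2)"
proof -
  obtain d1 where d1: "velocity d1 g1" "\<forall>s\<in>{0..1}. norm (d1 s) < L"
    using g1 by (auto simp: speed_bounded_def)
  obtain d2 where d2: "velocity d2 g2" "\<forall>s\<in>{0..1}. norm (d2 s) < L"
    using g2 by (auto simp: speed_bounded_def)
  obtain S where S: "finite S" "{0, 1} \<subseteq> S"
    "\<And>s. s \<in> {0..1} - S \<Longrightarrow> (g1 has_vector_derivative d1 s) (at s)"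
    using d1(1) velocity_cont by metis
  obtain T where T: "finite T" "{0, 1} \<subseteq> T"
    "\<And>s. s \<in> {0..1} - T \<Longrightarrow> (g2 has_vector_derivative d2 s) (at s)"
    using d2(1) velocity_cont by metis
  define e where "e r = (if r \<le> 1/2 then 2 * d1 (2 * r) else 2 * d2 (2 * r - 1))" for r
  have "velocity e (g1 +++ g2)"
    unfolding velocity_def
  proof (intro conjI exI[of _ "(\<lambda>r. 2 * r) -` S \<union> (\<lambda>r. 2 * r + -1) -` T \<union> {1/2}"] ballI)
    have e: "(\<lambda>s. Re (e s)) = (\<lambda>r. if r \<le> 1/2 then 2 * Re (d1 (2 * r)) else 2 * Re (d2 (2 * r - 1)))"
      "(\<lambda>s. Im (e s)) = (\<lambda>r. if r \<le> 1/2 then 2 * Im (d1 (2 * r)) else 2 * Im (d2 (2 * r - 1)))"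
      by (auto simp: e_def)
    show "(\<lambda>s. Re (e s)) \<in> FPWS" "(\<lambda>s. Im (e s)) \<in> FPWS"
      unfolding e using d1(1) d2(1) FPWS_join[of "\<lambda>s. Re (d1 s)" "\<lambda>s. Re (d2 s)"]
        FPWS_join[of "\<lambda>s. Im (d1 s)" "\<lambda>s. Im (d2 s)"] unfolding velocity_def by blast+
    show "continuous_on {0..1} (g1 +++ g2)"
      using d1(1) d2(1) assms(3)
      by (auto simp: velocity_def pathstart_def pathfinish_def intro!: continuous_on_joinpaths)
    show "finite ((\<lambda>r. 2 * r) -` S \<union> (\<lambda>r. 2 * r + -1) -` T \<union> {1/2})"
      using S(1) T(1) by (auto intro!: finite_vimageI simp: inj_def)
    fix r :: real assume r: "r \<in> {0<..<1} - ((\<lambda>r. 2 * r) -` S \<union> (\<lambda>r. 2 * r + -1) -` T \<union> {1/2})"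
    show "((g1 +++ g2) has_vector_derivative e r) (at r)"
    proof (cases "r < 1/2")
      case True
      have "((\<lambda>r. 2 * r) has_vector_derivative 2) (at r)"
        by (auto intro!: derivative_eq_intros simp flip: has_real_derivative_iff_has_vector_derivative)
      moreover have "(g1 has_vector_derivative d1 (2 * r)) (at (2 * r))"
        using True r by (intro S(3)) auto
      ultimately have "((g1 \<circ> (\<lambda>r. 2 * r)) has_vector_derivative 2 *\<^sub>R d1 (2 * r)) (at r)"
        by (intro vector_diff_chain_at)
      then have "((g1 \<circ> (\<lambda>r. 2 * r)) has_vector_derivative e r) (at r)"
        using True by (simp add: e_def scaleR_conv_of_real)
      then show ?thesis
        by (rule has_vector_derivative_transform_within_open[of _ _ _ "{..<1/2}"])
          (use True in \<open>auto simp: joinpaths_def\<close>)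
    next
      case False
      then have r2: "r > 1/2" using r by auto
      have "((\<lambda>r. 2 * r - 1) has_vector_derivative 2) (at r)"
        by (auto intro!: derivative_eq_intros simp flip: has_real_derivative_iff_has_vector_derivative)
      moreover have "(g2 has_vector_derivative d2 (2 * r - 1)) (at (2 * r - 1))"
        using r2 r by (intro T(3)) auto
      ultimately have "((g2 \<circ> (\<lambda>r. 2 * r - 1)) has_vector_derivative 2 *\<^sub>R d2 (2 * r - 1)) (at r)"
        by (intro vector_diff_chain_at)
      then have "((g2 \<circ> (\<lambda>r. 2 * r - 1)) has_vector_derivative e r) (at r)"
        using r2 by (simp add: e_def scaleR_conv_of_real)
      then show ?thesis
        by (rule has_vector_derivative_transform_within_open[of _ _ _ "{1/2<..}"])
          (use r2 in \<open>auto simp: joinpaths_def\<close>)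
    qed
  qed
  moreover have "norm (e r) < 2 * L" if "r \<in> {0..1}" for r
    using that d1(2) d2(2) by (auto simp: e_def norm_mult)
  ultimately show ?thesis unfolding speed_bounded_def by blast
qed

section \<open>The invariant as a contour integral\<close>

text \<open>The real part of \<open>flux_form P z * dz\<close> is \<open>P\<^sub>y dx - P\<^sub>x dy\<close>. Writing the 1-form this way
  makes the calculus of contour integrals available, although this integrand is in general not
  holomorphic.\<close>
definition flux_form :: "(complex \<Rightarrow> real) \<Rightarrow> complex \<Rightarrow> complex" where
  "flux_form P z = Complex (partial_y P z) (partial_x P z)"

lemma has_integral_Re_Im:
  fixes d :: "real \<Rightarrow> complex"
  assumes "(d has_integral w) S"
  shows "((\<lambda>s. Re (d s)) has_integral Re w) S" "((\<lambda>s. Im (d s)) has_integral Im w) S"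
  using has_integral_linear[OF assms bounded_linear_Re] has_integral_linear[OF assms bounded_linear_Im]
  by (simp_all add: o_def)

lemma velocity_pair_in_Xstar:
  assumes v: "velocity d g" and bd: "\<forall>s\<in>{0..1}. norm (d s) < L" and closed: "g 1 = g 0"
  shows "(\<lambda>s. Re (d s) / L, \<lambda>s. - Im (d s) / L) \<in> Xstar"
proof -
  have "norm (d 0) < L" using bd by simp
  then have L: "L > 0" using norm_ge_zero[of "d 0"] by linarith
  have "(\<lambda>s. Re (d s) / L) \<in> FPWS" "(\<lambda>s. - Im (d s) / L) \<in> FPWS"
    using v FPWS_cmult[of "\<lambda>s. Re (d s)" "1 / L"] FPWS_cmult[of "\<lambda>s. Im (d s)" "- 1 / L"]
    by (simp_all add: velocity_def)
  moreover have "\<bar>Re (d s) / L\<bar>\<^sup>2 + \<bar>- Im (d s) / L\<bar>\<^sup>2 < 1" if "s \<in> {0..1}" for s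
  proof -
    have "(norm (d s))\<^sup>2 < L\<^sup>2" using bd that by (intro power_strict_mono) auto
    then have "(norm (d s))\<^sup>2 / L\<^sup>2 < 1" using L by simp
    then show ?thesis by (simp add: cmod_power2 power_divide add_divide_distrib)
  qed
  moreover have "integral {0..1} (\<lambda>s. Re (d s) / L) = 0" "integral {0..1} (\<lambda>s. - Im (d s) / L) = 0"
    using has_integral_Re_Im[OF velocity_has_integral[OF v, of 0 1]] closed
    by (auto simp: integral_unique)
  ultimately show ?thesis unfolding Xstar_def by blast
qed

text \<open>The curve rebuilt from the pair is \<open>g\<close> on the unit interval, but its coordinates are only
  guaranteed to have the derivatives \<open>Re (d s)\<close> and \<open>Im (d s)\<close> off the breakpoints of \<open>d\<close>; the
  integrands agree up to a finite set.\<close>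
lemma Lambda_curve_eq_contour_integral:
  assumes v: "velocity d g" and L: "L > 0" and cont: "continuous_on UNIV (flux_form P)"
  shows "Lambda_curve P (g 0) (2 * L) (\<lambda>s. Re (d s) / L) (\<lambda>s. - Im (d s) / L)
           = Re (contour_integral g (flux_form P))"
proof -
  let ?\<gamma>1 = "gamma1 (g 0) (2 * L) (\<lambda>s. Re (d s) / L)"
  let ?\<gamma>2 = "gamma2 (g 0) (2 * L) (\<lambda>s. - Im (d s) / L)"
  have \<gamma>: "?\<gamma>1 r = Re (g r)" "?\<gamma>2 r = Im (g r)" if "r \<in> {0..1}" for r
    using has_integral_Re_Im[OF velocity_has_integral[OF v, of 0 r]] that L
    by (auto simp: gamma1_def gamma2_def integral_unique)
  obtain S where S: "finite S" "{0, 1} \<subseteq> S"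
    "\<And>s. s \<in> {0..1} - S \<Longrightarrow> (g has_vector_derivative d s) (at s)"
    using velocity_cont[OF v] by metis
  have d: "deriv ?\<gamma>1 s = Re (d s)" "deriv ?\<gamma>2 s = Im (d s)" if "s \<in> {0..1} - S" for s
  proof -
    have s: "s \<in> {0<..<1}" using that S(2) by (auto simp: less_le)
    have *: "((\<lambda>s. Re (g s)) has_real_derivative Re (d s)) (at s)"
      "((\<lambda>s. Im (g s)) has_real_derivative Im (d s)) (at s)"
      using S(3)[OF that] by (auto simp: has_vector_derivative_complex_iff)
    have "(?\<gamma>1 has_real_derivative Re (d s)) (at s)"
      by (rule has_field_derivative_transform_within_open[OF *(1), of "{0<..<1}"]) (use s \<gamma> in auto)
    moreover have "(?\<gamma>2 has_real_derivative Im (d s)) (at s)"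
      by (rule has_field_derivative_transform_within_open[OF *(2), of "{0<..<1}"]) (use s \<gamma> in auto)
    ultimately show "deriv ?\<gamma>1 s = Re (d s)" "deriv ?\<gamma>2 s = Im (d s)"
      by (auto intro: DERIV_imp_deriv)
  qed
  note ci = has_contour_integral_velocity[OF v cont]
  have "((\<lambda>s. Re (flux_form P (g s) * d s)) has_integral Re (contour_integral g (flux_form P))) {0..1}"
    using has_integral_Re_Im(1)[OF integrable_integral[OF ci(2)]] contour_integral_unique[OF ci(1)]
    by simp
  then have "((\<lambda>r. partial_y P (Complex (?\<gamma>1 r) (?\<gamma>2 r)) * deriv ?\<gamma>1 r
        - partial_x P (Complex (?\<gamma>1 r) (?\<gamma>2 r)) * deriv ?\<gamma>2 r)
      has_integral Re (contour_integral g (flux_form P))) {0..1}"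
  proof (rule has_integral_spike_finite[OF S(1), rotated])
    fix s assume s: "s \<in> {0..1} - S"
    then have "s \<in> {0..1}" by simp
    then show "partial_y P (Complex (?\<gamma>1 s) (?\<gamma>2 s)) * deriv ?\<gamma>1 s
        - partial_x P (Complex (?\<gamma>1 s) (?\<gamma>2 s)) * deriv ?\<gamma>2 s = Re (flux_form P (g s) * d s)"
      unfolding \<gamma>(1)[OF \<open>s \<in> {0..1}\<close>] \<gamma>(2)[OF \<open>s \<in> {0..1}\<close>] d[OF s] by (simp add: flux_form_def)
  qed
  then show ?thesis unfolding Lambda_curve_def by (rule integral_unique)
qed

text \<open>Every pair arises from a closed curve. The pair is recovered from \<open>d\<close> as an equation between
  functions on the whole line, so that the previous lemma applies to it literally.\<close>
lemma Xstar_curve: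
  assumes "(\<alpha>, \<beta>) \<in> Xstar" and "\<delta> > 0"
  obtains d g where "velocity d g" "\<forall>s\<in>{0..1}. norm (d s) < \<delta> / 2" "g 0 = z0" "g 1 = z0"
    "\<alpha> = (\<lambda>s. Re (d s) / (\<delta> / 2))" "\<beta> = (\<lambda>s. - Im (d s) / (\<delta> / 2))"
proof -
  define d where "d s = Complex (\<delta> / 2 * \<alpha> s) (- (\<delta> / 2) * \<beta> s)" for s
  define g where "g r = z0 + integral {0..r} d" for r
  have X: "\<alpha> \<in> FPWS" "\<beta> \<in> FPWS" "\<And>s. s \<in> {0..1} \<Longrightarrow> \<bar>\<alpha> s\<bar>\<^sup>2 + \<bar>\<beta> s\<bar>\<^sup>2 < 1"
    "integral {0..1} \<alpha> = 0" "integral {0..1} \<beta> = 0"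
    using assms(1) by (auto simp: Xstar_def)
  have parts: "(\<lambda>s. Re (d s)) \<in> FPWS" "(\<lambda>s. Im (d s)) \<in> FPWS"
    using FPWS_cmult[OF X(1), of "\<delta> / 2"] FPWS_cmult[OF X(2), of "- (\<delta> / 2)"]
    by (simp_all add: d_def)
  have int: "d integrable_on {0..1}"
    using integrable_mult_FPWS_parts[OF parts, of "\<lambda>_. 1"] by simp
  obtain S where S: "finite S" "\<And>s. s \<in> {0<..<1} - S \<Longrightarrow> isCont d s"
    using FPWS_parts_isCont[OF parts] by metis
  have "(g has_vector_derivative d s) (at s)" if s: "s \<in> {0<..<1} - S" for s
  proof -
    have "((\<lambda>u. integral {0..u} d) has_vector_derivative d s) (at s within {0..1} - {})"
      using S(2)[OF s] s
      by (intro integral_has_vector_derivative_continuous_at int)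
        (auto intro: continuous_at_imp_continuous_at_within)
    then have "((\<lambda>u. integral {0..u} d) has_vector_derivative d s) (at s)"
      using s by (simp add: at_within_Icc_at)
    from has_vector_derivative_add[OF has_vector_derivative_const[of z0] this]
    show ?thesis by (simp add: g_def[abs_def])
  qed
  then have "velocity d g"
    using parts S(1) int unfolding velocity_def g_def[abs_def]
    by (auto intro!: continuous_intros indefinite_integral_continuous_1)
  moreover have "norm (d s) < \<delta> / 2" if "s \<in> {0..1}" for s
  proof -
    have "(norm (Complex (h * a) (- h * b)))\<^sup>2 = h\<^sup>2 * (\<bar>a\<bar>\<^sup>2 + \<bar>b\<bar>\<^sup>2)" for h a b :: real
      by (simp add: cmod_power2 power_mult_distrib distrib_left)
    then have "(norm (d s))\<^sup>2 = (\<delta> / 2)\<^sup>2 * (\<bar>\<alpha> s\<bar>\<^sup>2 + \<bar>\<beta> s\<bar>\<^sup>2)"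
      unfolding d_def .
    also have "\<dots> < (\<delta> / 2)\<^sup>2 * 1"
      using X(3)[OF that] assms(2) by (intro mult_strict_left_mono) auto
    finally show ?thesis
      using power_less_imp_less_base[of "norm (d s)" 2 "\<delta> / 2"] assms(2) by simp
  qed
  moreover have "g 1 = z0"
  proof -
    note di = has_integral_Re_Im[OF integrable_integral[OF int]]
    have "Re (integral {0..1} d) = \<delta> / 2 * integral {0..1} \<alpha>"
      using integral_unique[OF di(1)] by (simp add: d_def)
    moreover have "Im (integral {0..1} d) = - (\<delta> / 2) * integral {0..1} \<beta>"
      using integral_unique[OF di(2)] by (simp add: d_def)
    ultimately show ?thesis by (simp add: g_def complex_eq_iff X)
  qed
  moreover have "g 0 = z0" by (simp add: g_def)
  moreover have "\<alpha> = (\<lambda>s. Re (d s) / (\<delta> / 2))" "\<beta> = (\<lambda>s. - Im (d s) / (\<delta> / 2))"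
    using assms(2) by (auto simp: d_def)
  ultimately show ?thesis using that[of d g] by blast
qed

section \<open>Filling a loop by small loops\<close>

lemma contour_integral_subpath_sum:
  fixes K n :: nat
  assumes "F contour_integrable_on g" "valid_path g" "K > 0" "n \<le> K"
  shows "(\<Sum>j<n. contour_integral (subpath (j / K) (Suc j / K) g) F)
           = contour_integral (subpath 0 (n / K) g) F"
  using assms(4)
proof (induction n)
  case (Suc n)
  then show ?case
    using contour_integral_subpath_combine[OF assms(1,2), of 0 "n / K" "Suc n / K"] assms(3)
    by auto
qed simp

text \<open>The map \<open>(s, t) \<mapsto> g 0 + s (g t - g 0)\<close> fills the loop \<open>g\<close> by the cone with apex \<open>g 0\<close>. In
  a \<open>K \<times> K\<close> grid the boundary of a cell consists of two scaled arcs of \<open>g\<close> and two radial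
  segments, all of length at most about \<open>L / K\<close>. Summing the cell integrals, the arcs telescope in \<open>s\<close>
  and the radial segments telescope in \<open>t\<close>. What is left is \<open>g\<close> itself: the arc at \<open>s = 0\<close> is
  constant, and the radial segments at \<open>t = 0\<close> and \<open>t = 1\<close> are degenerate because \<open>g\<close> is
  closed.\<close>
lemma contour_integral_loop_le_grid:
  fixes F :: "complex \<Rightarrow> complex" and K :: nat and M :: real
  assumes F: "continuous_on UNIV F" and g: "speed_bounded L g" "g 1 = g 0"
    and K: "K > 0" "8 * L / K \<le> L'"
    and small: "\<And>h. speed_bounded L' h \<Longrightarrow> h 1 = h 0 \<Longrightarrow> \<bar>Re (contour_integral h F)\<bar> \<le> M"
  shows "\<bar>Re (contour_integral g F)\<bar> \<le> (real K)\<^sup>2 * M"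
proof -
  define G where "G i t = g 0 + of_real (real i / K) * (g t - g 0)" for i t
  define S where "S i j = subpath (real j / K) (Suc j / K) (G i)" for i j
  define R where "R i j = linepath (G i (real j / K)) (G (Suc i) (real j / K))" for i j
  define cell where "cell i j = (S i j +++ R i (Suc j)) +++ (reversepath (S (Suc i) j) +++ reversepath (R i j))"
    for i j
  obtain d where "norm (d (0::real) :: complex) < L"
    using g(1) by (force simp: speed_bounded_def)
  then have L: "L > 0" using norm_ge_zero[of "d 0"] by linarith
  have frac: "real j / K \<in> {0..1}" if "j \<le> K" for j using that K by simp
  have affine: "a + c * (b - a) = a - c * a + c * b" for a b c :: complex
    by (simp add: algebra_simps)
  have G: "speed_bounded L (G i)" if "i \<le> K" for i
  proof (cases "i = 0")
    case True
    then have "G i = linepath (g 0) (g 0)" by (auto simp: G_def linepath_def algebra_simps simp flip: of_real_add)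
    then show ?thesis using L by (simp add: speed_bounded_linepath)
  next
    case False
    have "real i / K * L \<le> L" using that K L by (intro mult_left_le_one_le) auto
    then have "speed_bounded L (\<lambda>r. (g 0 - of_real (real i / K) * g 0) + of_real (real i / K) * g (1 * r + 0))"
      using False K by (intro speed_bounded_affine[OF g(1)]) auto
    moreover have "G i = (\<lambda>r. (g 0 - of_real (real i / K) * g 0) + of_real (real i / K) * g (1 * r + 0))"
      by (rule ext) (simp only: G_def affine mult_1 add_0_right)
    ultimately show ?thesis by (simp only:)
  qed
  have S: "speed_bounded (2 * L / K) (S i j)" if "i \<le> K" "j < K" for i j
    unfolding S_def
  proof (rule speed_bounded_subpath[OF G[OF that(1)]])
    show "(real (Suc j) / K - real j / K) * L \<le> 2 * L / K"
      using K L by (simp add: field_simps)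
  qed (use K that in \<open>auto simp: divide_strict_right_mono\<close>)
  have R: "speed_bounded (2 * L / K) (R i j)" if "i < K" "j \<le> K" for i j
    unfolding R_def
  proof (rule speed_bounded_linepath)
    have "G (Suc i) (real j / K) - G i (real j / K) = (g (real j / K) - g 0) / of_nat K"
      using K by (simp add: G_def field_simps)
    then have "norm (G (Suc i) (real j / K) - G i (real j / K)) = norm (g (real j / K) - g 0) / K"
      by (simp add: norm_divide)
    also have "\<dots> \<le> L / K"
      using speed_bounded_dist[OF g(1) frac[OF that(2)]] by (simp add: divide_right_mono)
    also have "\<dots> < 2 * L / K" using K L by (simp add: divide_strict_right_mono)
    finally show "norm (G (Suc i) (real j / K) - G i (real j / K)) < 2 * L / K" .
  qed
  have S_ends: "S i j 0 = G i (real j / K)" "S i j 1 = G i (real (Suc j) / K)" for i j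
    by (auto simp: S_def subpath_def)
  have R_ends: "R i j 0 = G i (real j / K)" "R i j 1 = G (Suc i) (real j / K)" for i j
    by (auto simp: R_def linepath_def)
  have cell_loop: "cell i j 1 = cell i j 0" for i j
    by (simp add: cell_def joinpaths_def reversepath_def S_ends R_ends)
  have cell_speed: "speed_bounded L' (cell i j)" if "i < K" "j < K" for i j
  proof -
    \<comment> \<open>Two levels of concatenation multiply the speed by 4.\<close>
    have "speed_bounded (2 * (2 * (2 * L / K))) (cell i j)"
      unfolding cell_def using that
      by (intro speed_bounded_join speed_bounded_reversepath S R)
        (simp_all add: joinpaths_def reversepath_def S_ends R_ends)
    then show ?thesis using K(2) by (auto elim: speed_bounded_mono)
  qed
  have cell_integral: "contour_integral (cell i j) F
      = (contour_integral (S i j) F - contour_integral (S (Suc i) j) F)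
        + (contour_integral (R i (Suc j)) F - contour_integral (R i j) F)"
    if "i < K" "j < K" for i j
  proof -
    have valid: "valid_path (S i j)" "valid_path (S (Suc i) j)" "valid_path (R i j)" "valid_path (R i (Suc j))"
      using that by (simp_all add: speed_bounded_valid_path[OF S] speed_bounded_valid_path[OF R])
    have ints: "F contour_integrable_on (S i j)" "F contour_integrable_on (S (Suc i) j)"
      "F contour_integrable_on (R i j)" "F contour_integrable_on (R i (Suc j))"
      using that by (simp_all add: speed_bounded_integrable[OF S F] speed_bounded_integrable[OF R F])
    have ends: "pathfinish (S i j) = pathstart (R i (Suc j))"
      "pathfinish (R i (Suc j)) = pathfinish (S (Suc i) j)"
      "pathstart (S (Suc i) j) = pathfinish (R i j)"
      by (simp_all add: pathstart_def pathfinish_def S_ends R_ends)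
    show ?thesis
      using valid ints ends unfolding cell_def
      by (simp add: valid_path_join contour_integral_reversepath contour_integrable_reversepath)
  qed
  have outer: "(\<Sum>j<K. contour_integral (S K j) F) = contour_integral g F"
  proof -
    have "G K = g" using K by (auto simp: G_def)
    then show ?thesis
      using contour_integral_subpath_sum[OF speed_bounded_integrable[OF g(1) F]
          speed_bounded_valid_path[OF g(1)] K(1) order_refl] K
      by (simp add: S_def)
  qed
  have inner: "contour_integral (S 0 j) F = 0" for j
  proof -
    have "S 0 j = linepath (g 0) (g 0)"
      by (auto simp: S_def subpath_def G_def linepath_def algebra_simps simp flip: of_real_add)
    then show ?thesis by simp
  qed
  have sides: "contour_integral (R i 0) F = 0" "contour_integral (R i K) F = 0" for i
    using g(2) K by (simp_all add: R_def G_def)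
  have radial: "(\<Sum>j<K. contour_integral (R i (Suc j)) F - contour_integral (R i j) F) = 0" for i
    using sum_lessThan_telescope[of "\<lambda>j. contour_integral (R i j) F" K] sides by simp
  have angular: "(\<Sum>i<K. contour_integral (S i j) F - contour_integral (S (Suc i) j) F)
      = - contour_integral (S K j) F" for j
    using sum_lessThan_telescope'[of "\<lambda>i. contour_integral (S i j) F" K] inner by simp
  have "(\<Sum>i<K. \<Sum>j<K. contour_integral (cell i j) F)
      = (\<Sum>i<K. \<Sum>j<K. (contour_integral (S i j) F - contour_integral (S (Suc i) j) F)
        + (contour_integral (R i (Suc j)) F - contour_integral (R i j) F))"
    by (intro sum.cong refl cell_integral) auto
  also have "\<dots> = (\<Sum>i<K. \<Sum>j<K. contour_integral (S i j) F - contour_integral (S (Suc i) j) F)"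
    unfolding sum.distrib radial by simp
  also have "\<dots> = (\<Sum>j<K. \<Sum>i<K. contour_integral (S i j) F - contour_integral (S (Suc i) j) F)"
    by (rule sum.swap)
  also have "\<dots> = - contour_integral g F"
    unfolding angular sum_negf outer ..
  finally have "Re (contour_integral g F) = - (\<Sum>i<K. \<Sum>j<K. Re (contour_integral (cell i j) F))"
    by (simp flip: Re_sum)
  then have "\<bar>Re (contour_integral g F)\<bar> \<le> (\<Sum>i<K. \<bar>\<Sum>j<K. Re (contour_integral (cell i j) F)\<bar>)"
    by (simp add: sum_abs)
  also have "\<dots> \<le> (\<Sum>i<K. \<Sum>j<K. \<bar>Re (contour_integral (cell i j) F)\<bar>)"
    by (intro sum_mono sum_abs)
  also have "\<dots> \<le> (\<Sum>i<K. \<Sum>j<K. M)"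
    by (intro sum_mono small cell_speed cell_loop) auto
  finally show ?thesis by (simp add: power2_eq_square)
qed

section \<open>Winding around a point where the Laplacian does not vanish\<close>

text \<open>Both sine and cosine terms are admitted because this family, unlike its members, is closed under
  differentiation.\<close>
lemma FPWS_trig: "(\<lambda>s. a * sin (c * s) + b * cos (c * s)) \<in> FPWS"
proof (rule FPWS_smooth)
  have D: "((\<lambda>s. a * sin (c * s) + b * cos (c * s)) has_real_derivative
      (- (c * b)) * sin (c * s) + (c * a) * cos (c * s)) (at s)" for a b s :: real
    by (auto intro!: derivative_eq_intros simp: algebra_simps)
  fix k s
  have "\<exists>a' b'. (deriv ^^ k) (\<lambda>s. a * sin (c * s) + b * cos (c * s))
      = (\<lambda>s. a' * sin (c * s) + b' * cos (c * s))"
  proof (induction k)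
    case (Suc k)
    then obtain a' b' where "(deriv ^^ k) (\<lambda>s. a * sin (c * s) + b * cos (c * s))
        = (\<lambda>s. a' * sin (c * s) + b' * cos (c * s))" by blast
    then have "(deriv ^^ Suc k) (\<lambda>s. a * sin (c * s) + b * cos (c * s))
        = (\<lambda>s. (- (c * b')) * sin (c * s) + (c * a') * cos (c * s))"
      using DERIV_imp_deriv[OF D[of a' b']] by (simp only: funpow.simps o_apply) (rule ext)
    then show ?case by blast
  qed auto
  then obtain a' b' where eq: "(deriv ^^ k) (\<lambda>s. a * sin (c * s) + b * cos (c * s))
      = (\<lambda>s. a' * sin (c * s) + b' * cos (c * s))" by blast
  show "(deriv ^^ k) (\<lambda>s. a * sin (c * s) + b * cos (c * s)) differentiable (at s)"
    unfolding eq real_differentiable_def using D[of a' b' s] by blast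
qed

text \<open>On a circle of radius \<open>r\<close> the first-order Taylor polynomials of \<open>p\<close> and \<open>q\<close> contribute exactly
  \<open>- \<pi> r\<^sup>2 (p\<^sub>y + q\<^sub>x)\<close> per turn to the integral of \<open>p dx - q dy\<close>, whereas the remainders are
  \<open>o(r)\<close> along a curve of length \<open>2 \<pi> r\<close>.
  The number \<open>n\<close> of turns is a parameter because the relative error does not depend on it.\<close>
lemma contour_integral_circle_approx:
  fixes p q :: "complex \<Rightarrow> real"
  assumes p: "p differentiable (at z)" and q: "q differentiable (at z)"
    and cont: "continuous_on UNIV (\<lambda>w. Complex (p w) (q w))"
    and \<epsilon>: "\<epsilon> > 0"
  shows "\<exists>\<rho>>0. \<forall>r n. 0 < r \<longrightarrow> r < \<rho> \<longrightarrow>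
       (\<exists>g. velocity (\<lambda>s. of_real (r * (2 * pi * real n)) * \<i> * cis (2 * pi * real n * s)) g \<and> g 1 = g 0 \<and>
         \<bar>Re (contour_integral g (\<lambda>w. Complex (p w) (q w)))
           + real n * r\<^sup>2 * pi * (partial_y p z + partial_x q z)\<bar> \<le> real n * r\<^sup>2 * pi * \<epsilon>)"
proof -
  \<comment> \<open>The radius is chosen for the relative error \<open>\<epsilon>/4\<close>: the two remainders, integrated over a
    length of \<open>2 \<pi> r n\<close>, then contribute at most \<open>\<pi> \<epsilon> n r\<^sup>2\<close>.\<close>
  have taylor: "\<exists>\<rho>>0. \<forall>w. norm (w - z) < \<rho> \<longrightarrow>
      \<bar>u w - (u z + (partial_x u z * Re (w - z) + partial_y u z * Im (w - z)))\<bar> \<le> \<epsilon> / 4 * norm (w - z)"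
    if u: "u differentiable (at z)" for u :: "complex \<Rightarrow> real"
  proof -
    let ?D = "frechet_derivative u (at z)"
    have D: "(u has_derivative ?D) (at z)" using u by (simp add: frechet_derivative_works)
    then have lin: "linear ?D" by (rule has_derivative_linear)
    have "?D h = partial_x u z * Re h + partial_y u z * Im h" for h
    proof -
      have "h = Re h *\<^sub>R 1 + Im h *\<^sub>R \<i>" by (simp add: complex_eq_iff)
      then have "?D h = ?D (Re h *\<^sub>R 1 + Im h *\<^sub>R \<i>)" by simp
      also have "\<dots> = Re h *\<^sub>R ?D 1 + Im h *\<^sub>R ?D \<i>"
        by (simp only: linear_add[OF lin] linear_cmul[OF lin])
      finally show ?thesis by (simp add: partial_x_def partial_y_def algebra_simps)
    qed
    moreover obtain \<rho> where "\<rho> > 0"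
      "\<forall>w. norm (w - z) < \<rho> \<longrightarrow> norm (u w - u z - ?D (w - z)) \<le> \<epsilon> / 4 * norm (w - z)"
      using D \<epsilon> unfolding has_derivative_at_alt by (metis zero_less_divide_iff zero_less_numeral)
    ultimately show ?thesis by (intro exI[of _ \<rho>]) (auto simp: algebra_simps)
  qed
  obtain \<rho>1 where \<rho>1: "\<rho>1 > 0" "\<And>w. norm (w - z) < \<rho>1 \<Longrightarrow>
      \<bar>p w - (p z + (partial_x p z * Re (w - z) + partial_y p z * Im (w - z)))\<bar> \<le> \<epsilon> / 4 * norm (w - z)"
    using taylor[OF p] by blast
  obtain \<rho>2 where \<rho>2: "\<rho>2 > 0" "\<And>w. norm (w - z) < \<rho>2 \<Longrightarrow>
      \<bar>q w - (q z + (partial_x q z * Re (w - z) + partial_y q z * Im (w - z)))\<bar> \<le> \<epsilon> / 4 * norm (w - z)"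
    using taylor[OF q] by blast
  have "\<exists>g. velocity (\<lambda>s. of_real (r * (2 * pi * real n)) * \<i> * cis (2 * pi * real n * s)) g \<and> g 1 = g 0 \<and>
         \<bar>Re (contour_integral g (\<lambda>w. Complex (p w) (q w)))
           + real n * r\<^sup>2 * pi * (partial_y p z + partial_x q z)\<bar> \<le> real n * r\<^sup>2 * pi * \<epsilon>"
    if r: "0 < r" "r < min \<rho>1 \<rho>2" for r n
  proof -
    define \<omega> where "\<omega> = 2 * pi * real n"
    define d where "d s = of_real (r * \<omega>) * \<i> * cis (\<omega> * s)" for s
    define g where "g s = z + of_real r * cis (\<omega> * s)" for s
    have \<omega>: "cos \<omega> = 1" "sin \<omega> = 0" "\<omega> \<ge> 0"
      using cos_int_2pin[of "int n"] sin_int_2pin[of "int n"] by (simp_all add: \<omega>_def)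
    have der: "(g has_vector_derivative d s) (at s)" for s
    proof -
      have "((\<lambda>s. Re (g s)) has_real_derivative Re (d s)) (at s)"
        "((\<lambda>s. Im (g s)) has_real_derivative Im (d s)) (at s)"
        unfolding g_def d_def by (auto intro!: derivative_eq_intros)
      then show ?thesis by (simp add: has_vector_derivative_complex_iff)
    qed
    have v: "velocity d g"
      unfolding velocity_def
    proof (intro conjI exI[of _ "{}"])
      show "(\<lambda>s. Re (d s)) \<in> FPWS" "(\<lambda>s. Im (d s)) \<in> FPWS"
        using FPWS_trig[of "- (r * \<omega>)" \<omega> 0] FPWS_trig[of 0 \<omega> "r * \<omega>"] by (simp_all add: d_def)
      show "continuous_on {0..1} g"
        using der by (meson continuous_at_imp_continuous_on has_vector_derivative_continuous)
    qed (use der in auto)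
    \<comment> \<open>The contribution of the first-order Taylor polynomials, with an explicit primitive.\<close>
    define lin where "lin s =
        (p z + (partial_x p z * (r * cos (\<omega> * s)) + partial_y p z * (r * sin (\<omega> * s)))) * Re (d s)
      - (q z + (partial_x q z * (r * cos (\<omega> * s)) + partial_y q z * (r * sin (\<omega> * s)))) * Im (d s)" for s
    define A where "A s = p z * r * cos (\<omega> * s) + partial_x p z * r\<^sup>2 * (cos (\<omega> * s))\<^sup>2 / 2
        - partial_y p z * r\<^sup>2 * (\<omega> * s - sin (\<omega> * s) * cos (\<omega> * s)) / 2
        - q z * r * sin (\<omega> * s) - partial_x q z * r\<^sup>2 * (\<omega> * s + sin (\<omega> * s) * cos (\<omega> * s)) / 2
        - partial_y q z * r\<^sup>2 * (sin (\<omega> * s))\<^sup>2 / 2" for s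
    have "(A has_real_derivative lin s) (at s)" for s
    proof -
      define S C where "S = sin (\<omega> * s)" and "C = cos (\<omega> * s)"
      have "(A has_real_derivative - (p z * r * (\<omega> * S)) - partial_x p z * r\<^sup>2 * (\<omega> * S * C)
          - partial_y p z * r\<^sup>2 * (\<omega> - \<omega> * (C\<^sup>2 - S\<^sup>2)) / 2 - q z * r * (\<omega> * C)
          - partial_x q z * r\<^sup>2 * (\<omega> + \<omega> * (C\<^sup>2 - S\<^sup>2)) / 2
          - partial_y q z * r\<^sup>2 * (\<omega> * S * C)) (at s)"
        unfolding A_def S_def C_def
        by (rule derivative_eq_intros refl | simp)+ (simp add: power2_eq_square algebra_simps)
      note A = this
      have "C\<^sup>2 = 1 - S\<^sup>2" by (simp add: S_def C_def cos_squared_eq)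
      then have half: "\<omega> - \<omega> * (C\<^sup>2 - S\<^sup>2) = 2 * (\<omega> * S * S)" "\<omega> + \<omega> * (C\<^sup>2 - S\<^sup>2) = 2 * (\<omega> * C * C)"
        unfolding power2_eq_square by algebra+
      show ?thesis
        by (rule DERIV_cong[OF A[unfolded half]])
          (simp add: lin_def d_def power2_eq_square algebra_simps flip: S_def C_def)
    qed
    then have "(lin has_integral A 1 - A 0) {0..1}"
      by (intro fundamental_theorem_of_calculus)
        (auto simp: has_real_derivative_iff_has_vector_derivative intro: has_vector_derivative_at_within)
    moreover have "A 1 - A 0 = - (real n * r\<^sup>2 * pi * (partial_y p z + partial_x q z))"
      using \<omega> by (simp add: A_def) (simp add: \<omega>_def field_simps)
    ultimately have lin: "(lin has_integral - (real n * r\<^sup>2 * pi * (partial_y p z + partial_x q z))) {0..1}"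
      by simp
    note ci = has_contour_integral_velocity[OF v cont]
    have full: "((\<lambda>s. Re (Complex (p (g s)) (q (g s)) * d s)) has_integral
        Re (contour_integral g (\<lambda>w. Complex (p w) (q w)))) {0..1}"
      using has_integral_Re_Im(1)[OF integrable_integral[OF ci(2)]] contour_integral_unique[OF ci(1)]
      by simp
    have "norm (Re (contour_integral g (\<lambda>w. Complex (p w) (q w)))
        - - (real n * r\<^sup>2 * pi * (partial_y p z + partial_x q z))) \<le> real n * r\<^sup>2 * pi * \<epsilon> * measure lborel {0..1::real}"
    proof (rule has_integral_bound_real[OF _ finite.emptyI has_integral_diff[OF full lin]])
      show "0 \<le> real n * r\<^sup>2 * pi * \<epsilon>" using \<epsilon> by simp
      fix s :: real
      have gz: "norm (g s - z) = r" "Re (g s - z) = r * cos (\<omega> * s)" "Im (g s - z) = r * sin (\<omega> * s)"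
        using r by (simp_all add: g_def norm_mult)
      define ep where "ep = p (g s) - (p z + (partial_x p z * (r * cos (\<omega> * s)) + partial_y p z * (r * sin (\<omega> * s))))"
      define eq where "eq = q (g s) - (q z + (partial_x q z * (r * cos (\<omega> * s)) + partial_y q z * (r * sin (\<omega> * s))))"
      have e: "\<bar>ep\<bar> \<le> \<epsilon> / 4 * r" "\<bar>eq\<bar> \<le> \<epsilon> / 4 * r"
        using \<rho>1(2)[of "g s"] \<rho>2(2)[of "g s"] r unfolding gz ep_def eq_def by auto
      have nd: "norm (d s) = r * \<omega>" using r \<omega>(3) by (simp add: d_def norm_mult)
      have "Re (Complex (p (g s)) (q (g s)) * d s) - lin s = ep * Re (d s) - eq * Im (d s)"
        by (simp add: lin_def ep_def eq_def algebra_simps)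
      also have "\<bar>\<dots>\<bar> \<le> \<bar>ep\<bar> * \<bar>Re (d s)\<bar> + \<bar>eq\<bar> * \<bar>Im (d s)\<bar>"
        by (simp add: abs_mult[symmetric])
      also have "\<dots> \<le> \<epsilon> / 4 * r * (r * \<omega>) + \<epsilon> / 4 * r * (r * \<omega>)"
        using e abs_Re_le_cmod[of "d s"] abs_Im_le_cmod[of "d s"] nd r \<epsilon>
        by (intro add_mono mult_mono) auto
      also have "\<dots> = real n * r\<^sup>2 * pi * \<epsilon>"
        by (simp add: \<omega>_def power2_eq_square)
      finally show "norm (Re (Complex (p (g s)) (q (g s)) * d s) - lin s) \<le> real n * r\<^sup>2 * pi * \<epsilon>"
        by simp
    qed
    moreover have "g 1 = g 0" using \<omega> by (simp add: g_def complex_eq_iff)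
    ultimately show ?thesis
      using v unfolding d_def \<omega>_def by (intro exI[of _ g]) auto
  qed
  then show ?thesis using \<rho>1(1) \<rho>2(1) by (intro exI[of _ "min \<rho>1 \<rho>2"]) auto
qed

section \<open>Growth of the invariant\<close>

lemma graph_in_frontier_Omega: "(z, \<i> * of_real (P z)) \<in> frontier (Omega P)"
proof -
  have "\<exists>y\<in>Omega P. dist y (z, \<i> * of_real (P z)) < e" if "e > 0" for e
  proof (intro bexI)
    show "(z, \<i> * of_real (P z + e / 2)) \<in> Omega P"
      using that by (simp add: Omega_def)
    have "\<i> * of_real (P z + e / 2) - \<i> * of_real (P z) = \<i> * of_real (e / 2)"
      by (simp add: algebra_simps)
    then show "dist (z, \<i> * of_real (P z + e / 2)) (z, \<i> * of_real (P z)) < e"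
      using that by (simp add: dist_Pair_Pair dist_norm norm_mult del: of_real_add of_real_divide)
  qed
  then have "(z, \<i> * of_real (P z)) \<in> closure (Omega P)" by (auto simp: closure_approachable)
  moreover have "(z, \<i> * of_real (P z)) \<notin> Omega P" by (simp add: Omega_def)
  ultimately show ?thesis using interior_subset by (auto simp: frontier_def)
qed

text \<open>This and the next lemma replace the supremum over pairs by one over closed curves. The second
  coordinate \<open>w\<close> is arbitrary because the invariant only sees the base point of the curve.\<close>
lemma Lambda_ge_loop:
  assumes "speed_bounded (\<delta> / 2) g" "g 1 = g 0" "continuous_on UNIV (flux_form P)"
  shows "ereal \<bar>Re (contour_integral g (flux_form P))\<bar> \<le> Lambda P (g 0, w) \<delta>"
proof -
  obtain d where d: "velocity d g" "\<forall>s\<in>{0..1}. norm (d s) < \<delta> / 2"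
    using assms(1) by (auto simp: speed_bounded_def)
  then have "norm (d 0) < \<delta> / 2" by simp
  then have L: "\<delta> / 2 > 0" using norm_ge_zero[of "d 0"] by linarith
  show ?thesis
    unfolding Lambda_def
    using Lambda_curve_eq_contour_integral[OF d(1) L assms(3)]
    by (intro SUP_upper2[OF velocity_pair_in_Xstar[OF d assms(2)]]) simp
qed

lemma Lambda_le_loops:
  assumes "\<delta> > 0" "continuous_on UNIV (flux_form P)"
    and "\<And>g. speed_bounded (\<delta> / 2) g \<Longrightarrow> g 1 = g 0 \<Longrightarrow> \<bar>Re (contour_integral g (flux_form P))\<bar> \<le> M"
  shows "Lambda P p \<delta> \<le> ereal M"
  unfolding Lambda_def
proof (rule SUP_least, clarify)
  fix \<alpha> \<beta> assume X: "(\<alpha>, \<beta>) \<in> Xstar"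
  obtain d g where d: "velocity d g" "\<forall>s\<in>{0..1}. norm (d s) < \<delta> / 2"
    and g: "g 0 = fst p" "g 1 = fst p"
    and eq: "\<alpha> = (\<lambda>s. Re (d s) / (\<delta> / 2))" "\<beta> = (\<lambda>s. - Im (d s) / (\<delta> / 2))"
    by (rule Xstar_curve[OF X assms(1), of "fst p"]) (rule that)
  have "Lambda_curve P (fst p) \<delta> \<alpha> \<beta> = Re (contour_integral g (flux_form P))"
    using Lambda_curve_eq_contour_integral[OF d(1) _ assms(2), of "\<delta> / 2"] assms(1) g
    by (simp add: eq)
  then show "ereal \<bar>Lambda_curve P (fst p) \<delta> \<alpha> \<beta>\<bar> \<le> ereal M"
    using assms(3)[of g] d g by (auto simp: speed_bounded_def)
qed

lemma Lambda_quadratic_upper_bound: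
  assumes cont: "continuous_on UNIV (flux_form P)" and pos: "0 < \<delta>0" "\<delta>0 \<le> \<delta>"
    and small: "\<And>z. Lambda P (z, \<i> * of_real (P z)) \<delta>0 \<le> ereal M"
  shows "Lambda P p \<delta> \<le> ereal ((9 * \<delta> / \<delta>0)\<^sup>2 * M)"
proof (rule Lambda_le_loops[OF _ cont])
  show "\<delta> > 0" using pos by simp
  have loop: "\<bar>Re (contour_integral h (flux_form P))\<bar> \<le> M" if "speed_bounded (\<delta>0 / 2) h" "h 1 = h 0" for h
    using order_trans[OF Lambda_ge_loop[OF that cont] small[of "h 0"]] by simp
  have "0 \<le> M" using loop[of "linepath 0 0"] pos speed_bounded_linepath[of 0 0 "\<delta>0 / 2"] by simp
  fix g assume g: "speed_bounded (\<delta> / 2) g" "g 1 = g 0"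
  define K where "K = nat \<lceil>8 * \<delta> / \<delta>0\<rceil>"
  \<comment> \<open>The grid lemma shrinks speed \<open>\<delta>/2\<close> to \<open>8 (\<delta>/2) / K\<close>, which has to be at most \<open>\<delta>0/2\<close>.\<close>
  have "8 * \<delta> / \<delta>0 \<ge> 8" using pos by (simp add: field_simps)
  then have K: "real K \<ge> 8 * \<delta> / \<delta>0" "K > 0" "real K \<le> 8 * \<delta> / \<delta>0 + 1"
    unfolding K_def by linarith+
  have "8 * (\<delta> / 2) / K \<le> \<delta>0 / 2" using K pos by (simp add: field_simps)
  from contour_integral_loop_le_grid[OF cont g K(2) this loop]
  have "\<bar>Re (contour_integral g (flux_form P))\<bar> \<le> (real K)\<^sup>2 * M" .
  moreover have "1 \<le> \<delta> / \<delta>0" using pos by simp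
  then have "real K \<le> 9 * \<delta> / \<delta>0" using K(3) by simp
  then have "(real K)\<^sup>2 * M \<le> (9 * \<delta> / \<delta>0)\<^sup>2 * M"
    using \<open>0 \<le> M\<close> by (intro mult_right_mono power_mono) auto
  ultimately show "\<bar>Re (contour_integral g (flux_form P))\<bar> \<le> (9 * \<delta> / \<delta>0)\<^sup>2 * M"
    by (rule order_trans)
qed

lemma Lambda_linear_lower_bound:
  assumes diff: "partial_y P differentiable (at z)" "partial_x P differentiable (at z)"
    and cont: "continuous_on UNIV (flux_form P)"
    and lap: "partial_x (partial_x P) z + partial_y (partial_y P) z \<noteq> 0" and \<delta>0: "\<delta>0 > 0"
  obtains c where "c > 0" "\<And>\<delta>. \<delta> \<ge> \<delta>0 \<Longrightarrow> \<exists>w. ereal (c * \<delta>) \<le> Lambda P (w, \<i> * of_real (P w)) \<delta>"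
proof -
  define l where "l = partial_y (partial_y P) z + partial_x (partial_x P) z"
  have l: "\<bar>l\<bar> > 0" using lap by (simp add: l_def)
  obtain \<rho> where \<rho>: "\<rho> > 0" "\<forall>r n. 0 < r \<longrightarrow> r < \<rho> \<longrightarrow>
       (\<exists>g. velocity (\<lambda>s. of_real (r * (2 * pi * real n)) * \<i> * cis (2 * pi * real n * s)) g \<and> g 1 = g 0 \<and>
         \<bar>Re (contour_integral g (flux_form P)) + real n * r\<^sup>2 * pi * l\<bar> \<le> real n * r\<^sup>2 * pi * (\<bar>l\<bar> / 2))"
    using contour_integral_circle_approx[OF diff cont[unfolded flux_form_def[abs_def]] half_gt_zero[OF l],
        folded flux_form_def l_def]
    by (elim exE conjE)
  \<comment> \<open>The second bound on \<open>r\<close> guarantees that at every scale \<open>\<delta> \<ge> \<delta>0\<close> at least one full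
    turn is possible.\<close>
  define r where "r = min (\<rho> / 2) (\<delta>0 / (8 * pi))"
  have r: "0 < r" "r < \<rho>" "8 * pi * r \<le> \<delta>0"
  proof -
    show "0 < r" "r < \<rho>" using \<rho>(1) \<delta>0 by (auto simp: r_def)
    have "r \<le> \<delta>0 / (8 * pi)" by (simp add: r_def)
    then show "8 * pi * r \<le> \<delta>0" by (simp add: field_simps)
  qed
  have "\<exists>w. ereal (r * \<bar>l\<bar> / 32 * \<delta>) \<le> Lambda P (w, \<i> * of_real (P w)) \<delta>" if \<delta>: "\<delta> \<ge> \<delta>0" for \<delta>
  proof -
    \<comment> \<open>With at most \<open>\<delta> / (8 \<pi> r)\<close> turns the speed is at most \<open>\<delta>/4\<close>; rounding down loses at most
      half of the turns.\<close>
    define x where "x = \<delta> / (8 * pi * r)"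
    define n where "n = nat \<lfloor>x\<rfloor>"
    have x: "x \<ge> 1" using r \<delta> by (simp add: x_def)
    have "real n = of_int \<lfloor>x\<rfloor>" "\<lfloor>x\<rfloor> \<ge> 1" using x by (simp_all add: n_def le_floor_iff)
    then have n: "real n \<le> x" "real n \<ge> x / 2" by linarith+
    have xr: "x * (8 * pi * r) = \<delta>" using r by (simp add: x_def)
    obtain g where g: "velocity (\<lambda>s. of_real (r * (2 * pi * real n)) * \<i> * cis (2 * pi * real n * s)) g"
      "g 1 = g 0"
      "\<bar>Re (contour_integral g (flux_form P)) + real n * r\<^sup>2 * pi * l\<bar> \<le> real n * r\<^sup>2 * pi * (\<bar>l\<bar> / 2)"
      using \<rho>(2)[rule_format, OF r(1,2), of n] by blast
    have "r * (2 * pi * real n) \<le> r * (2 * pi * x)"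
      using n(1) r by (intro mult_left_mono) auto
    also have "\<dots> = \<delta> / 4" using xr by (simp add: algebra_simps)
    also have "\<dots> < \<delta> / 2" using \<delta> \<delta>0 by simp
    finally have "speed_bounded (\<delta> / 2) g"
      using g(1) r unfolding speed_bounded_def by (intro exI conjI) (auto simp: norm_mult)
    from Lambda_ge_loop[OF this g(2) cont]
    have "ereal \<bar>Re (contour_integral g (flux_form P))\<bar> \<le> Lambda P (g 0, \<i> * of_real (P (g 0))) \<delta>" .
    moreover have "r * \<bar>l\<bar> / 32 * \<delta> \<le> \<bar>Re (contour_integral g (flux_form P))\<bar>"
    proof -
      have "r * \<bar>l\<bar> / 32 * \<delta> = x / 2 * (r\<^sup>2 * pi * \<bar>l\<bar> / 2)"
        unfolding xr[symmetric] by (simp add: power2_eq_square)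
      also have "\<dots> \<le> real n * (r\<^sup>2 * pi * \<bar>l\<bar> / 2)"
        using n(2) by (intro mult_right_mono) auto
      also have "\<dots> \<le> \<bar>Re (contour_integral g (flux_form P))\<bar>"
      proof -
        have "\<bar>real n * r\<^sup>2 * pi * l\<bar> = 2 * (real n * r\<^sup>2 * pi * (\<bar>l\<bar> / 2))"
          by (simp add: abs_mult)
        with g(3) have "real n * r\<^sup>2 * pi * (\<bar>l\<bar> / 2) \<le> \<bar>Re (contour_integral g (flux_form P))\<bar>"
          by linarith
        then show ?thesis by (simp add: mult.assoc)
      qed
      finally show ?thesis .
    qed
    ultimately show ?thesis by (meson ereal_less_eq(3) order_trans)
  qed
  then show ?thesis using that[of "r * \<bar>l\<bar> / 32"] r(1) l by auto
qed

theorem theorem1p2: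
  fixes P :: "complex \<Rightarrow> real" and f :: "real \<Rightarrow> real" and \<delta>0 :: real
  assumes "smooth P" and "subharmonic P" and "\<not> harmonic P"
    and "uniform_global_structure P f \<delta>0"
  shows "\<exists>c>0. \<exists>C>0. \<forall>\<delta>\<ge>\<delta>0. c * \<delta> \<le> f \<delta> \<and> f \<delta> \<le> C * \<delta>\<^sup>2"
proof -
  have Ck: "Ck k P" for k using assms(1) by (simp add: smooth_def)
  have diff: "partial_y P differentiable (at z)" "partial_x P differentiable (at z)" for z
    using Ck[of 2] by (auto simp: numeral_2_eq_2 differentiable_on_def)
  have "continuous_on UNIV (\<lambda>z. of_real (partial_y P z) + \<i> * of_real (partial_x P z))"
    using Ck[of 1] by (intro continuous_intros) auto
  then have cont: "continuous_on UNIV (flux_form P)"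
    by (simp add: flux_form_def[abs_def] Complex_eq)
  obtain z where lap: "partial_x (partial_x P) z + partial_y (partial_y P) z \<noteq> 0"
    using assms(3) Ck[of 2] by (auto simp: harmonic_def)
  obtain A B where \<delta>0: "\<delta>0 > 0" and f: "\<And>\<delta>. \<delta> \<ge> \<delta>0 \<Longrightarrow> f \<delta> \<ge> 0" and AB: "A > 0" "B > 0"
    and ugs: "\<And>p \<delta>. p \<in> frontier (Omega P) \<Longrightarrow> \<delta> \<ge> \<delta>0 \<Longrightarrow>
        Lambda P p \<delta> \<le> ereal (A * f \<delta>) \<and> ereal (f \<delta>) \<le> ereal B * Lambda P p \<delta>"
    using assms(4) unfolding uniform_global_structure_def by blast
  obtain c where c: "c > 0"
    "\<And>\<delta>. \<delta> \<ge> \<delta>0 \<Longrightarrow> \<exists>w. ereal (c * \<delta>) \<le> Lambda P (w, \<i> * of_real (P w)) \<delta>"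
    using Lambda_linear_lower_bound[OF diff cont lap \<delta>0] by metis
  define C where "C = B * (81 / \<delta>0\<^sup>2 * (A * f \<delta>0)) + 1"
  have lower: "c / A * \<delta> \<le> f \<delta>" if \<delta>: "\<delta> \<ge> \<delta>0" for \<delta>
  proof -
    obtain w where "ereal (c * \<delta>) \<le> Lambda P (w, \<i> * of_real (P w)) \<delta>"
      using c(2)[OF \<delta>] by blast
    also have "\<dots> \<le> ereal (A * f \<delta>)" using ugs[OF graph_in_frontier_Omega \<delta>] by blast
    finally show ?thesis using AB by (simp add: field_simps)
  qed
  have upper: "f \<delta> \<le> C * \<delta>\<^sup>2" if \<delta>: "\<delta> \<ge> \<delta>0" for \<delta>
  proof -
    have "ereal (f \<delta>) \<le> ereal B * Lambda P (0, \<i> * of_real (P 0)) \<delta>"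
      using ugs[OF graph_in_frontier_Omega \<delta>] by blast
    also have "\<dots> \<le> ereal B * ereal ((9 * \<delta> / \<delta>0)\<^sup>2 * (A * f \<delta>0))"
      using AB ugs[OF graph_in_frontier_Omega order_refl]
      by (intro ereal_mult_left_mono Lambda_quadratic_upper_bound[OF cont \<delta>0 \<delta>]) auto
    finally have "f \<delta> \<le> B * ((9 * \<delta> / \<delta>0)\<^sup>2 * (A * f \<delta>0))" by simp
    also have "\<dots> = B * (81 / \<delta>0\<^sup>2 * (A * f \<delta>0)) * \<delta>\<^sup>2"
      by (simp add: power_mult_distrib power_divide)
    also have "\<dots> \<le> C * \<delta>\<^sup>2" by (intro mult_right_mono) (simp_all add: C_def)
    finally show ?thesis .
  qed
  have "C > 0" using AB f[of \<delta>0] by (simp add: C_def add_nonneg_pos)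
  moreover have "c / A > 0" using c(1) AB by simp
  ultimately show ?thesis using lower upper by blast
qed

end
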